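(* For every positive integer $s$, $n_3(s)=n_{3,lin}(s)$; that is, the maximal length $n$ for which an additive quaternary $[n,3,n-s]$-code exists equals the maximal length $n$ for which a linear $[n,3,n-s]_4$-code over $\mathbb{F}_4$ exists.
   Context: For $k$ with $2k$ a positive integer, an additive quaternary $[n,k,d]$-code is a $2k$-dimensional $\mathbb{F}_2$-linear subspace of $\mathbb{F}_2^{2n}$ whose coordinates are grouped into $n$ pairs, codewords being viewed as $n$-tuples with entries in $\mathbb{F}_2^2$, with $d$ the minimum Hamming distance over these $n$ symbols. The species is $s=n-d$. $n_k(s)$ denotes the maximal $n$ such that an additive quaternary $[n,k,n-s]$-code exists, and for integer $k$, $n_{k,lin}(s)$ denotes the maximal $n$ such that a linear $[n,k,n-s]_4$-code over $\mathbb{F}_4$ exists. *)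

theory Defs
  imports Complex_Main "HOL-Library.Function_Algebras" "HOL-Library.Z2" "HOL-Library.Cardinality"
begin

(* A word of length n over a field is a function on nat that vanishes from index n on, so that
   all the spaces of words of length n over one field live in a single type. *)

definition words :: "nat \<Rightarrow> (nat \<Rightarrow> 'a::zero) set" where
  "words n = {x. \<forall>i\<ge>n. x i = 0}"

definition word_scale :: "'a::field \<Rightarrow> (nat \<Rightarrow> 'a) \<Rightarrow> nat \<Rightarrow> 'a" where
  "word_scale c x = (\<lambda>i. c * x i)"

interpretation word: vector_space "word_scale :: 'a::field \<Rightarrow> _"
  by unfold_locales (auto simp: word_scale_def fun_eq_iff algebra_simps)

(* The symbols may come from any type: they are field elements for linear codes, pairs of bits
   for additive codes. *)

definition hamming_dist :: "nat \<Rightarrow> (nat \<Rightarrow> 'b) \<Rightarrow> (nat \<Rightarrow> 'b) \<Rightarrow> nat" where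
  "hamming_dist n x y = card {i. i < n \<and> x i \<noteq> y i}"

definition min_distance :: "nat \<Rightarrow> (nat \<Rightarrow> 'b) set \<Rightarrow> nat" where
  "min_distance n D = Min {hamming_dist n x y | x y. x \<in> D \<and> y \<in> D \<and> x \<noteq> y}"

definition linear_code :: "nat \<Rightarrow> nat \<Rightarrow> nat \<Rightarrow> (nat \<Rightarrow> 'a::field) set \<Rightarrow> bool" where
  "linear_code n k d C \<longleftrightarrow>
     C \<subseteq> words n \<and> word.subspace C \<and> 0 < k \<and> word.dim C = k \<and> min_distance n C = d"

(* The type bit is the field with two elements. *)

definition pair_symbols :: "(nat \<Rightarrow> bit) \<Rightarrow> nat \<Rightarrow> bit \<times> bit" where
  "pair_symbols x = (\<lambda>i. (x (2 * i), x (2 * i + 1)))"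

definition additive_code :: "nat \<Rightarrow> rat \<Rightarrow> nat \<Rightarrow> (nat \<Rightarrow> bit) set \<Rightarrow> bool" where
  "additive_code n k d C \<longleftrightarrow>
     C \<subseteq> words (2 * n) \<and> word.subspace C \<and> 0 < k \<and> of_nat (word.dim C) = 2 * k \<and>
     min_distance n (pair_symbols ` C) = d"

(* Lengths of the codes of species s = n - d, written without truncated subtraction. *)

definition additive_lengths :: "rat \<Rightarrow> nat \<Rightarrow> nat set" where
  "additive_lengths k s = {n. \<exists>d C. additive_code n k d C \<and> n = d + s}"

definition linear_lengths :: "'a::field itself \<Rightarrow> nat \<Rightarrow> nat \<Rightarrow> nat set" where
  "linear_lengths F k s = {n. \<exists>d (C :: (nat \<Rightarrow> 'a) set). linear_code n k d C \<and> n = d + s}"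

(* On nat, Sup is the maximum of a nonempty finite set, and Sup {} = 0: the value is 0 if there
   is no code of species s (for k = 3 this happens when s = 1, by the Singleton bound). *)

definition max_additive_length :: "rat \<Rightarrow> nat \<Rightarrow> nat" where
  "max_additive_length k s = Sup (additive_lengths k s)"

definition max_linear_length :: "'a::field itself \<Rightarrow> nat \<Rightarrow> nat \<Rightarrow> nat" where
  "max_linear_length F k s = Sup (linear_lengths F k s)"

(* For k = 3 both suprema are over finite sets: among more words than there are symbols, some two
   agree at any given coordinate, and two distinct codewords agree in at most s coordinates. *)

lemma length_bound:
  fixes D :: "(nat \<Rightarrow> 'b) set"
  assumes "T \<subseteq> D" "finite T" "finite (UNIV :: 'b set)" "CARD('b) < card T"
    and "n = min_distance n D + s"
  shows "n \<le> card T * card T * s"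
proof -
  let ?P = "{(x, y) \<in> T \<times> T. x \<noteq> y}"
  let ?A = "\<lambda>(x, y). {i. i < n \<and> x i = y i}"
  have fin: "finite {hamming_dist n x y | x y. x \<in> D \<and> y \<in> D \<and> x \<noteq> y}"
  proof (rule finite_subset)
    show "{hamming_dist n x y | x y. x \<in> D \<and> y \<in> D \<and> x \<noteq> y} \<subseteq> {..n}"
    proof clarsimp
      fix x y :: "nat \<Rightarrow> 'b"
      have "card {i. i < n \<and> x i \<noteq> y i} \<le> card {..<n}" by (rule card_mono) auto
      then show "hamming_dist n x y \<le> n" by (simp add: hamming_dist_def)
    qed
  qed simp
  have A: "card (?A p) \<le> s" if "p \<in> ?P" for p
  proof -
    obtain x y where p: "p = (x, y)" "x \<in> D" "y \<in> D" "x \<noteq> y"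
      using \<open>p \<in> ?P\<close> assms(1) by auto
    have "min_distance n D \<le> hamming_dist n x y"
      unfolding min_distance_def using fin p by (intro Min_le) auto
    moreover have "card {i. i < n \<and> x i = y i} + hamming_dist n x y
        = card ({i. i < n \<and> x i = y i} \<union> {i. i < n \<and> x i \<noteq> y i})"
      unfolding hamming_dist_def by (subst card_Un_disjoint) auto
    moreover have "{i. i < n \<and> x i = y i} \<union> {i. i < n \<and> x i \<noteq> y i} = {..<n}" by auto
    ultimately show ?thesis using assms(5) p by simp
  qed
  have "{..<n} \<subseteq> (\<Union>p\<in>?P. ?A p)"
  proof
    fix i assume i: "i \<in> {..<n}"
    have "\<not> inj_on (\<lambda>x. x i) T"
    proof
      assume "inj_on (\<lambda>x. x i) T"
      then have "card T \<le> CARD('b)" using assms(3) by (metis card_inj_on_le subset_UNIV)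
      then show False using assms(4) by simp
    qed
    then obtain x y where "x \<in> T" "y \<in> T" "x i = y i" "x \<noteq> y" by (auto simp: inj_on_def)
    then show "i \<in> (\<Union>p\<in>?P. ?A p)" using i by fastforce
  qed
  moreover have finP: "finite ?P" by (rule finite_subset[of _ "T \<times> T"]) (use assms(2) in auto)
  ultimately have "card {..<n} \<le> card (\<Union>p\<in>?P. ?A p)"
    by (intro card_mono) auto
  also have "\<dots> \<le> (\<Sum>p\<in>?P. card (?A p))" by (rule card_UN_le[OF finP])
  also have "\<dots> \<le> card ?P * s" using sum_bounded_above[of ?P "\<lambda>p. card (?A p)" s] A by simp
  also have "\<dots> \<le> card (T \<times> T) * s"
    by (intro mult_right_mono card_mono) (use assms(2) in auto)
  finally show ?thesis by (simp add: card_cartesian_product)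
qed

lemma inj_pair_symbols: "inj pair_symbols"
proof (rule injI, rule ext)
  fix x y i assume eq: "pair_symbols x = pair_symbols y"
  have "pair_symbols x (i div 2) = pair_symbols y (i div 2)" by (simp add: eq)
  then show "x i = y i"
    by (cases "even i") (auto simp: pair_symbols_def elim: evenE oddE)
qed

lemma finite_additive_lengths: "finite (additive_lengths 3 s)"
proof (rule finite_subset)
  have UN: "(UNIV :: bit set) = {0, 1}"
    using bit_not_zero_iff by auto
  have fin: "finite (UNIV :: (bit \<times> bit) set)" "CARD(bit \<times> bit) = 4"
    unfolding UNIV_Times_UNIV[symmetric] UN card_cartesian_product by auto
  show "additive_lengths 3 s \<subseteq> {..36 * s}"
  proof
    fix n assume "n \<in> additive_lengths 3 s"
    then obtain C where C: "of_nat (word.dim C) = (2 * 3 :: rat)"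
        and n: "n = min_distance n (pair_symbols ` C) + s"
      by (auto simp: additive_lengths_def additive_code_def)
    have "word.dim C = 6" using C by linarith
    then obtain B where B: "B \<subseteq> C" "card B = 6" using word.basis_exists by metis
    then have "finite B" using card.infinite by fastforce
    moreover have "card (pair_symbols ` B) = 6"
      using card_image[OF inj_on_subset[OF inj_pair_symbols]] B(2) by auto
    ultimately have "n \<le> 6 * 6 * s"
      using length_bound[of "pair_symbols ` B" "pair_symbols ` C" n s] B(1) n fin by auto
    then show "n \<in> {..36 * s}" by simp
  qed
qed simp

lemma finite_linear_lengths:
  assumes "CARD('f::field) = 4"
  shows "finite (linear_lengths TYPE('f) 3 s)"
proof (rule finite_subset)
  have fin: "finite (UNIV :: 'f set)" using assms card.infinite by fastforce
  show "linear_lengths TYPE('f) 3 s \<subseteq> {..25 * s}"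
  proof
    fix n assume "n \<in> linear_lengths TYPE('f) 3 s"
    then obtain C :: "(nat \<Rightarrow> 'f) set" where C: "word.dim C = 3" "word.subspace C"
        and n: "n = min_distance n C + s"
      by (auto simp: linear_lengths_def linear_code_def)
    obtain B where B: "B \<subseteq> C" "card B = 3" "\<not> word.dependent B"
      using word.basis_exists C(1) by metis
    obtain a b c where abc: "B = {a, b, c}" "a \<noteq> b" "b \<noteq> c" "a \<noteq> c"
      using B(2) by (metis card_3_iff)
    have z: "0 \<notin> B" using B(3) word.dependent_zero by blast
    have "a + b \<noteq> 0"
    proof
      assume "a + b = 0"
      then have "a = word_scale (- 1) b"
        by (auto simp: word_scale_def fun_eq_iff eq_neg_iff_add_eq_0)
      moreover have "word_scale (- 1) b \<in> word.span (B - {a})"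
        using abc by (intro word.span_scale word.span_base) auto
      ultimately have "a \<in> word.span (B - {a})" by metis
      then show False using B(3) abc(1) word.dependent_def by blast
    qed
    moreover have "a + b \<noteq> c"
    proof
      assume "a + b = c"
      moreover have "a + b \<in> word.span (B - {c})"
        using abc by (intro word.span_add word.span_base) auto
      ultimately show False using B(3) abc(1) word.dependent_def by blast
    qed
    moreover have "a \<noteq> 0" "b \<noteq> 0" "c \<noteq> 0" using z abc(1) by auto
    ultimately have "card {0, a + b, a, b, c} = 5" using abc by auto
    moreover have "{0, a + b, a, b, c} \<subseteq> C"
      using B(1) abc(1) C(2) word.subspace_0 word.subspace_add by auto
    ultimately have "n \<le> 5 * 5 * s"
      using length_bound[of "{0, a + b, a, b, c}" C n s] n fin assms by auto
    then show "n \<in> {..25 * s}" by simp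
  qed
qed simp

end

(* Upper bound: replacing every symbol (a, b) of an additive code by (a, b, a + b) gives a binary
   code of length 3n and dimension 6 in which all weights are doubled, and the Griesmer bound for it
   yields the true maximum for every s except s = 3, where it leaves n = 10 and n = 11 open.  A code
   with s = 3 and n = 10 is ten 4-dimensional subspaces of F_2^6 such that every nonzero vector
   lies in at most three of them.  Let the defect of a vector be 3 minus the number of subspaces
   containing it.  Counting shows that no defect is 2 and that exactly eight vectors have defect 3,
   while subspaces of dimension 3, 4, 5 have total defect at most 11, at most 15 and congruent to
   3 mod 4, at most 23.  These bounds make any four of the eight vectors independent and let some
   five of them sum to zero, and the defects they force nearby add up to too much.

   Lower bound: a linear code is a multiset of points of PG(2,4) with at most s of them on a line.
   Take copies of the whole plane together with nothing, a zero coordinate, a hyperoval, a Hermitian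
   curve (s = 3), two planes with a line removed from each, or an affine plane. *)
theory Submission
  imports Defs "HOL-Library.FuncSet" "HOL-Library.Product_Plus"
begin

section \<open>Groups of exponent two\<close>

text \<open>Additive groups with x + x = 0 stand in for vector spaces over the field with two
  elements: subspaces are then just subgroups. The parameter \<open>ty\<close> pins the type
  variable.\<close>

locale exponent_two =
  fixes ty :: "'a::ab_group_add itself"
  assumes double: "\<And>x::'a. x + x = 0"
begin

lemma double_left: "x + (x + y) = (y::'a)"
  by (simp add: double add.assoc[symmetric])

lemmas double_simps = add_ac double double_left

lemma add_eq_0: "x + y = 0 \<longleftrightarrow> x = (y::'a)"
  by (metis add.right_neutral double double_left)

definition subgrp :: "'a set \<Rightarrow> bool" where
  "subgrp U \<longleftrightarrow> 0 \<in> U \<and> (\<forall>x\<in>U. \<forall>y\<in>U. x + y \<in> U)"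

lemma subgrp_adjoin:
  assumes "subgrp U"
  shows "subgrp (U \<union> (+) x ` U)"
proof -
  have U: "0 \<in> U" "\<And>u v. u \<in> U \<Longrightarrow> v \<in> U \<Longrightarrow> u + v \<in> U"
    using assms by (simp_all add: subgrp_def)
  have *: "x + u + (x + v) = u + v" for u v
    by (simp add: double_simps)
  have **: "v + (x + u) = x + (v + u)" for u v
    by (simp add: add_ac)
  show ?thesis unfolding subgrp_def
  proof (intro conjI ballI)
    fix a b assume "a \<in> U \<union> (+) x ` U" "b \<in> U \<union> (+) x ` U"
    then consider "a \<in> U" "b \<in> U" | u where "a = x + u" "u \<in> U" "b \<in> U"
      | v where "a \<in> U" "b = x + v" "v \<in> U"
      | u v where "a = x + u" "b = x + v" "u \<in> U" "v \<in> U"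
      by blast
    then show "a + b \<in> U \<union> (+) x ` U"
    proof cases
      case 2
      then have "a + b = x + (u + b)" by (simp add: add.assoc)
      then show ?thesis using 2 U by blast
    next
      case 3
      then have "a + b = x + (a + v)" by (simp add: **)
      then show ?thesis using 3 U by blast
    next
      case 4
      then show ?thesis using U(2)[of u v] by (simp add: *)
    qed (use U in auto)
  qed (use U in simp)
qed

lemma adjoin_disjoint:
  assumes "subgrp U" "x \<notin> U"
  shows "U \<inter> (+) x ` U = {}"
proof (rule ccontr)
  assume "U \<inter> (+) x ` U \<noteq> {}"
  then obtain u v where "u \<in> U" "v \<in> U" "u = x + v" by auto
  then have "u + v = x" by (simp add: double_simps)
  then show False using assms \<open>u \<in> U\<close> \<open>v \<in> U\<close> by (auto simp: subgrp_def)
qed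

lemma sum_adjoin:
  assumes "subgrp U" "finite U" "x \<notin> U"
  shows "sum h (U \<union> (+) x ` U) = (\<Sum>u\<in>U. h u + h (x + u))"
proof -
  have "sum h (U \<union> (+) x ` U) = sum h U + sum h ((+) x ` U)"
    using assms adjoin_disjoint by (intro sum.union_disjoint) auto
  then show ?thesis by (simp add: sum.reindex sum.distrib)
qed

lemma card_adjoin:
  assumes "subgrp U" "finite U" "x \<notin> U"
  shows "card (U \<union> (+) x ` U) = 2 * card U"
  using sum_adjoin[OF assms, of "\<lambda>_. 1::nat"] assms(2) by simp

text \<open>The span of a list, built by adjoining one coset at a time, so that
  \<open>sum_gen\<close> unfolds a sum over the span of independent vectors into an explicit sum
  over all their subset sums.\<close>

fun gen :: "'a list \<Rightarrow> 'a set" where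
  "gen [] = {0}"
| "gen (x # xs) = gen xs \<union> (+) x ` gen xs"

lemma subgrp_gen: "subgrp (gen xs)"
  by (induction xs) (simp_all add: subgrp_adjoin, simp add: subgrp_def)

lemma finite_gen: "finite (gen xs)"
  by (induction xs) auto

lemma gen_subset: "subgrp V \<Longrightarrow> set xs \<subseteq> V \<Longrightarrow> gen xs \<subseteq> V"
  by (induction xs) (auto simp: subgrp_def)

lemma card_gen: "x \<notin> gen xs \<Longrightarrow> card (gen (x # xs)) = 2 * card (gen xs)"
  by (simp add: card_adjoin subgrp_gen finite_gen)

lemma sum_gen: "x \<notin> gen xs \<Longrightarrow> sum h (gen (x # xs)) = (\<Sum>u\<in>gen xs. h u + h (x + u))"
  by (simp add: sum_adjoin subgrp_gen finite_gen)

lemma adjoin_absorb: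
  assumes "subgrp U" "x \<in> U"
  shows "U \<union> (+) x ` U = U"
  using assms by (auto simp: subgrp_def)

lemma card_gen_le: "card (gen xs) \<le> 2 ^ length xs"
proof (induction xs)
  case (Cons x xs)
  then show ?case
    using card_gen[of x xs] adjoin_absorb[OF subgrp_gen, of x xs] by (cases "x \<in> gen xs") auto
qed simp

lemma gen_snoc: "gen (xs @ [x]) = gen (x # xs)"
  by (induction xs) (auto simp: image_Un image_image add_ac)

text \<open>As \<open>f\<close> takes only two values, the part of \<open>U\<close> outside the
  kernel is empty or a single coset of the kernel.\<close>

lemma card_kernel:
  fixes f :: "'a \<Rightarrow> bit"
  assumes "subgrp U" "finite U" and f: "\<And>x y. f (x + y) = f x + f y"
  shows "card U \<in> {card {u \<in> U. f u = 0}, 2 * card {u \<in> U. f u = 0}}"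
proof (cases "\<forall>u\<in>U. f u = 0")
  case True
  then have "{u \<in> U. f u = 0} = U" by auto
  then show ?thesis by simp
next
  case False
  then obtain x where x: "x \<in> U" "f x = 1" by (auto simp: bit_not_zero_iff)
  let ?K = "{u \<in> U. f u = 0}"
  have "subgrp ?K"
    using assms(1) f[of 0 0] by (auto simp: subgrp_def f)
  moreover have "U = ?K \<union> (+) x ` ?K"
  proof (intro equalityI subsetI)
    fix u assume u: "u \<in> U"
    show "u \<in> ?K \<union> (+) x ` ?K"
    proof (cases "f u = 0")
      case False
      then have "x + u \<in> ?K" using u x assms(1) by (simp add: subgrp_def f bit_not_zero_iff)
      then have "x + (x + u) \<in> (+) x ` ?K" by (rule imageI)
      then show ?thesis by (simp add: double_left)
    qed (use u in auto)
  qed (use x assms(1) in \<open>auto simp: subgrp_def\<close>)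
  ultimately show ?thesis
    using card_adjoin[of ?K x] assms(2) x by auto
qed

end

section \<open>Ten subspaces of codimension two in dimension six\<close>

text \<open>
  The letters stand for weights on the points and the pairs of a five-element set.  For every triple,
  the three points, the three pairs inside it and the complementary pair have total weight 3.
\<close>

lemma triple_weights:
  fixes a b c d e ab ac ad ae bc bd be cd ce de :: nat
  assumes "b + c + d + bc + bd + cd + ae = 3"
    "b + c + e + bc + be + ce + ad = 3"
    "b + d + e + bd + be + de + ac = 3"
    "c + d + e + cd + ce + de + ab = 3"
    "a + b + c + ab + ac + bc + de = 3"
    "a + b + d + ab + ad + bd + ce = 3"
    "a + b + e + ab + ae + be + cd = 3"
    "a + c + d + ac + ad + cd + be = 3"
    "a + c + e + ac + ae + ce + bd = 3"
    "a + d + e + ad + ae + de + bc = 3"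
    and "(a + b + c + d + e) + (ab + ac + ad + ae + bc + bd + be + cd + ce + de) \<le> 5"
  shows "b = 1 \<and> e = 1"
proof -
  define P where "P = a + b + c + d + e"
  define Q where "Q = ab + ac + ad + ae + bc + bd + be + cd + ce + de"
  \<comment> \<open>Over the ten triples, a point is counted six times, and a pair three times as an
    inner pair and once as the complement. With P + Q \<le> 5 the total 30 forces Q = 0.\<close>
  have "6 * P + 4 * Q = (b + c + d + bc + bd + cd + ae) + (b + c + e + bc + be + ce + ad) +
    (b + d + e + bd + be + de + ac) + (c + d + e + cd + ce + de + ab) +
    (a + b + c + ab + ac + bc + de) + (a + b + d + ab + ad + bd + ce) +
    (a + b + e + ab + ae + be + cd) + (a + c + d + ac + ad + cd + be) +
    (a + c + e + ac + ae + ce + bd) + (a + d + e + ad + ae + de + bc)"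
    by (simp add: P_def Q_def)
  also have "\<dots> = 30" by (simp only: assms)
  finally have "Q = 0" using assms(11) P_def Q_def by linarith
  then have "b + c + d = 3" "b + c + e = 3" "b + d + e = 3" "c + d + e = 3"
    using assms(1-4) by (simp_all add: Q_def)
  then show ?thesis by linarith
qed

text \<open>\<open>V\<close> is the code, and \<open>f i\<close>, \<open>g i\<close> read off the
  two bits of symbol i. The assumption \<open>few\<close> says that a nonzero codeword vanishes in
  at most three of the first ten symbols.\<close>

locale ten_pairs = exponent_two ty for ty :: "'a::ab_group_add itself" +
  fixes V :: "'a set" and f g :: "nat \<Rightarrow> 'a \<Rightarrow> bit"
  assumes f_add: "f i (x + y) = f i x + f i y"
    and g_add: "g i (x + y) = g i x + g i y"
    and V: "subgrp V" "card V = 64"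
    and few: "u \<in> V \<Longrightarrow> u \<noteq> 0 \<Longrightarrow> card {i. i < 10 \<and> f i u = 0 \<and> g i u = 0} \<le> 3"
begin

section \<open>Incidence counts and defects\<close>

definition K :: "nat \<Rightarrow> 'a set" where
  "K i = {u \<in> V. f i u = 0 \<and> g i u = 0}"

definition zeros :: "'a \<Rightarrow> nat" where
  "zeros u = card {i. i < 10 \<and> f i u = 0 \<and> g i u = 0}"

text \<open>At 0, which lies in all ten subspaces, the value is set to 0; at other vectors of
  \<open>V\<close>, \<open>few\<close> keeps the subtraction from being truncated.\<close>

definition defect :: "'a \<Rightarrow> nat" where
  "defect u = (if u = 0 then 0 else 3 - zeros u)"

lemma finite_V: "finite V"
  using V(2) card.infinite by fastforce

lemma zero_maps: "f i 0 = 0" "g i 0 = 0"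
  using f_add[of i 0 0] g_add[of i 0 0] by simp_all

lemma subgrp_K: "subgrp (K i)"
  using V(1) by (auto simp: K_def subgrp_def f_add g_add zero_maps)

lemma zeros_0: "zeros 0 = 10"
  by (simp add: zeros_def zero_maps)

lemma zeros_le: "u \<in> V \<Longrightarrow> u \<noteq> 0 \<Longrightarrow> zeros u \<le> 3"
  using few by (simp add: zeros_def)

text \<open>The intersection arises by taking the kernel of \<open>f i\<close> and then that of
  \<open>g i\<close>; each step keeps the order or halves it.\<close>

lemma card_Int_K:
  assumes "subgrp U" "U \<subseteq> V"
  shows "card U = card (U \<inter> K i) \<or> card U = 2 * card (U \<inter> K i) \<or> card U = 4 * card (U \<inter> K i)"
proof -
  let ?W = "{u \<in> U. f i u = 0}"
  have fin: "finite U" using assms(2) finite_V finite_subset by blast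
  have W: "subgrp ?W" using assms(1) by (auto simp: subgrp_def f_add zero_maps)
  have "{u \<in> ?W. g i u = 0} = U \<inter> K i" using assms(2) by (auto simp: K_def)
  then have "card U \<in> {card ?W, 2 * card ?W}" "card ?W \<in> {card (U \<inter> K i), 2 * card (U \<inter> K i)}"
    using card_kernel[OF assms(1) fin, of "f i"] card_kernel[OF W, of "g i"] fin
    by (auto simp: f_add g_add)
  then show ?thesis by auto
qed

lemma card_Int_K_div:
  assumes "subgrp U" "U \<subseteq> V" "card U = 4 * m"
  shows "m dvd card (U \<inter> K i)" "m \<le> card (U \<inter> K i)"
proof -
  have "card (U \<inter> K i) = m * 4 \<or> card (U \<inter> K i) = m * 2 \<or> card (U \<inter> K i) = m"
    using card_Int_K[OF assms(1,2), of i] assms(3) by auto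
  then show "m dvd card (U \<inter> K i)" "m \<le> card (U \<inter> K i)" by auto
qed

text \<open>Double counting of the pairs (u, i) with u in \<open>K i\<close>, weighted by
  \<open>h u\<close>.\<close>

lemma sum_zeros:
  assumes "U \<subseteq> V"
  shows "(\<Sum>u\<in>U. zeros u * h u) = (\<Sum>i<10. \<Sum>u\<in>U \<inter> K i. h u)"
proof -
  have fin: "finite U" using assms finite_V finite_subset by blast
  have "(\<Sum>u\<in>U. zeros u * h u) = (\<Sum>u\<in>U. \<Sum>i<10. if u \<in> K i then h u else 0)"
  proof (rule sum.cong)
    fix u assume "u \<in> U"
    have "zeros u = card {i \<in> {..<10}. u \<in> K i}"
      unfolding zeros_def using \<open>u \<in> U\<close> assms by (intro arg_cong[where f = card]) (auto simp: K_def)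
    then show "zeros u * h u = (\<Sum>i<10. if u \<in> K i then h u else 0)"
      by (simp add: sum.If_cases Int_def)
  qed simp
  also have "\<dots> = (\<Sum>i<10. \<Sum>u\<in>U. if u \<in> K i then h u else 0)" by (rule sum.swap)
  also have "\<dots> = (\<Sum>i<10. \<Sum>u\<in>U \<inter> K i. h u)"
    using fin by (simp add: sum.inter_restrict)
  finally show ?thesis .
qed

text \<open>For a nonzero vector, defect and number of zeros add up to 3; for 0 they add up to 10 =
  3 + 7.\<close>

lemma sum_defect:
  assumes "subgrp U" "U \<subseteq> V"
  shows "sum defect U + (\<Sum>i<10. card (U \<inter> K i)) = 3 * card U + 7"
proof -
  have fin: "finite U" using assms finite_V finite_subset by blast
  have "sum defect U + (\<Sum>u\<in>U. zeros u * 1) = (\<Sum>u\<in>U. defect u + zeros u)"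
    by (simp add: sum.distrib)
  also have "\<dots> = (\<Sum>u\<in>U. 3 + (if u = 0 then 7 else 0))"
    using assms zeros_le by (intro sum.cong) (auto simp: defect_def zeros_0)
  also have "\<dots> = 3 * card U + 7"
    using fin assms(1) by (simp add: sum.distrib sum.delta subgrp_def)
  finally show ?thesis using sum_zeros[OF assms(2), of "\<lambda>_. 1"] by simp
qed

text \<open>Each of the ten intersections has even order at least 2, and in
  \<open>sum_defect\<close> the right-hand side is 31, so the defect is 31 minus an even number that
  is at least 20.\<close>

lemma defect_8:
  assumes "subgrp U" "U \<subseteq> V" "card U = 8"
  shows "sum defect U \<le> 11" "odd (sum defect U)"
proof -
  have *: "even (card (U \<inter> K i)) \<and> 2 \<le> card (U \<inter> K i)" for i
    using card_Int_K_div[OF assms(1,2), of 2 i] assms(3) by simp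
  define S where "S = (\<Sum>i<10. card (U \<inter> K i))"
  define D where "D = sum defect U"
  have "(\<Sum>i<(10::nat). 2) \<le> S"
    unfolding S_def using * by (intro sum_mono) auto
  moreover have "even S"
    unfolding S_def using * by (intro dvd_sum) auto
  moreover have "D + S = 31"
    using sum_defect[OF assms(1,2)] assms(3) by (simp add: S_def D_def)
  ultimately have "D \<le> 11 \<and> odd D"
    by simp presburger
  then show "sum defect U \<le> 11" "odd (sum defect U)" by (auto simp: D_def)
qed

text \<open>Here the defect is 55 minus a multiple of 4 that is at least 40.\<close>

lemma defect_16:
  assumes "subgrp U" "U \<subseteq> V" "card U = 16"
  shows "sum defect U \<le> 15" "sum defect U mod 4 = 3"
proof -
  have *: "4 dvd card (U \<inter> K i) \<and> 4 \<le> card (U \<inter> K i)" for i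
    using card_Int_K_div[OF assms(1,2), of 4 i] assms(3) by simp
  define S where "S = (\<Sum>i<10. card (U \<inter> K i))"
  define D where "D = sum defect U"
  have "(\<Sum>i<(10::nat). 4) \<le> S"
    unfolding S_def using * by (intro sum_mono) auto
  moreover have "4 dvd S"
    unfolding S_def using * by (intro dvd_sum) auto
  moreover have "D + S = 55"
    using sum_defect[OF assms(1,2)] assms(3) by (simp add: S_def D_def)
  ultimately have "D \<le> 15 \<and> D mod 4 = 3"
    by simp presburger
  then show "sum defect U \<le> 15" "sum defect U mod 4 = 3" by (auto simp: D_def)
qed

lemma defect_32:
  assumes "subgrp U" "U \<subseteq> V" "card U = 32"
  shows "sum defect U \<le> 23"
proof -
  have *: "8 \<le> card (U \<inter> K i)" for i
    using card_Int_K_div[OF assms(1,2), of 8 i] assms(3) by simp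
  have "(\<Sum>i<10. card (U \<inter> K i)) \<ge> (\<Sum>i<(10::nat). 8)"
    using * by (intro sum_mono) auto
  then show ?thesis
    using sum_defect[OF assms(1,2)] assms(3) by simp
qed

text \<open>Apply \<open>sum_defect\<close> to \<open>K i\<close> itself, which meets each of the
  other nine in at least a quarter of its order. Order 32 or 64 would give at least 72 > 71 or 144 >
  135. For order 16 the total is 39, and nine intersections of order at least 4 leave 3; one of
  order 8 would already exceed 39.\<close>

lemma K_structure:
  assumes "i < 10"
  shows "card (K i) = 16" "sum defect (K i) = 3"
    and "\<And>j. j < 10 \<Longrightarrow> j \<noteq> i \<Longrightarrow> card (K i \<inter> K j) = 4"
proof -
  have KV: "K i \<subseteq> V" by (auto simp: K_def)
  let ?J = "{..<10} - {i}"
  have cJ: "card ?J = 9" using assms by simp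
  have split: "sum defect (K i) + (\<Sum>j\<in>?J. card (K i \<inter> K j)) = 2 * card (K i) + 7"
    using sum_defect[OF subgrp_K KV] sum.remove[of "{..<10}" i "\<lambda>j. card (K i \<inter> K j)"] assms
    by simp
  have ge: "(\<Sum>j\<in>?J. card (K i \<inter> K j)) \<ge> 9 * m" if "\<And>j. m \<le> card (K i \<inter> K j)" for m
    using sum_bounded_below[of ?J m "\<lambda>j. card (K i \<inter> K j)"] that cJ by simp
  have c: "64 = card (K i) \<or> 64 = 2 * card (K i) \<or> 64 = 4 * card (K i)"
    using card_Int_K[OF V(1) order_refl, of i] V(2) KV by (simp add: Int_absorb1)
  have quarter: "card (K i) \<le> 4 * card (K i \<inter> K j)" for j
    using card_Int_K[OF subgrp_K KV, of j] by linarith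
  show 16: "card (K i) = 16"
  proof (rule ccontr)
    assume "card (K i) \<noteq> 16"
    then have c: "card (K i) = 32 \<or> card (K i) = 64" using c by arith
    have "card (K i) div 4 \<le> card (K i \<inter> K j)" for j using quarter[of j] by linarith
    then show False using ge[of "card (K i) div 4"] c split by auto
  qed
  have *: "4 dvd card (K i \<inter> K j) \<and> 4 \<le> card (K i \<inter> K j)" for j
    using card_Int_K_div[OF subgrp_K KV, of 4 j] 16 by simp
  show eq: "card (K i \<inter> K j) = 4" if j: "j < 10" "j \<noteq> i" for j
  proof (rule ccontr)
    assume "card (K i \<inter> K j) \<noteq> 4"
    then have "8 \<le> card (K i \<inter> K j)" using *[of j] by (auto simp: dvd_def)
    moreover have "card (?J - {j}) = 8" using cJ j by simp
    then have "(\<Sum>k\<in>?J - {j}. card (K i \<inter> K k)) \<ge> 8 * 4"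
      using sum_bounded_below[of "?J - {j}" 4 "\<lambda>k. card (K i \<inter> K k)"] * by simp
    ultimately show False
      using split 16 sum.remove[of ?J j "\<lambda>k. card (K i \<inter> K k)"] j by simp
  qed
  have "(\<Sum>j\<in>?J. card (K i \<inter> K j)) = (\<Sum>j\<in>?J. 4)"
    using eq by (intro sum.cong) auto
  then show "sum defect (K i) = 3" using split 16 cJ by simp
qed

text \<open>A vector u with one zero has defect 2, so the \<open>K i\<close> containing it has
  exactly one further vector v of nonzero defect, namely 1. A subgroup of order 8 in
  \<open>K i\<close> that avoids v then has even total defect, contrary to
  \<open>defect_8\<close>.\<close>

lemma zeros_neq_1:
  assumes "u \<in> V"
  shows "zeros u \<noteq> 1"
proof
  assume z: "zeros u = 1"
  have "{i. i < 10 \<and> f i u = 0 \<and> g i u = 0} \<noteq> {}"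
    using z unfolding zeros_def by fastforce
  then obtain i where i: "i < 10" "u \<in> K i" using assms by (auto simp: K_def)
  have u0: "u \<noteq> 0" using z zeros_0 by auto
  then have du: "defect u = 2" using z by (simp add: defect_def)
  have KV: "K i \<subseteq> V" and fin: "finite (K i)"
    using finite_V by (auto simp: K_def)
  have rest: "sum defect (K i - {u}) = 1"
    using K_structure(2)[OF i(1)] sum.remove[OF fin i(2), of defect] du by simp
  have "\<exists>v\<in>K i - {u}. defect v = 1 \<and> (\<forall>w\<in>K i - {u}. v \<noteq> w \<longrightarrow> defect w = 0)"
    using rest fin by (subst sum_eq_1_iff[symmetric]) auto
  then obtain v where v: "v \<in> K i - {u}" "defect v = 1" "\<forall>w\<in>K i - {u}. v \<noteq> w \<longrightarrow> defect w = 0"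
    by blast
  have v0: "v \<noteq> 0" using v(2) by (auto simp: defect_def)
  have ex: "\<exists>x\<in>K i. x \<notin> gen xs" if "card (gen xs) \<le> 8" for xs
  proof -
    have "\<not> K i \<subseteq> gen xs"
      using card_mono[OF finite_gen, of "K i" xs] that K_structure(1)[OF i(1)] by auto
    then show ?thesis by blast
  qed
  \<comment> \<open>Extend v to a basis v, x1, x2, x3 of \<open>K i\<close>; the span of x1, x2, x3
    is the required subgroup.\<close>
  have c1: "card (gen [v]) = 2" using v0 by (simp add: card_gen del: gen.simps(2))
  then obtain x1 where x1: "x1 \<in> K i" "x1 \<notin> gen [v]" using ex[of "[v]"] by auto
  then have c2: "card (gen [x1, v]) = 4" using c1 by (simp add: card_gen del: gen.simps(2))
  then obtain x2 where x2: "x2 \<in> K i" "x2 \<notin> gen [x1, v]" using ex[of "[x1, v]"] by auto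
  then have c3: "card (gen [x2, x1, v]) = 8" using c2 by (simp add: card_gen del: gen.simps(2))
  then obtain x3 where x3: "x3 \<in> K i" "x3 \<notin> gen [x2, x1, v]" using ex[of "[x2, x1, v]"] by auto
  then have c4: "card (gen [x3, x2, x1, v]) = 16" using c3 by (simp add: card_gen del: gen.simps(2))
  let ?W = "gen [x3, x2, x1]"
  have "gen [x3, x2, x1, v] = ?W \<union> (+) v ` ?W"
    using gen_snoc[of "[x3, x2, x1]" v] by (simp del: gen.simps(2)) simp
  then have "v \<notin> ?W"
    using c4 adjoin_absorb[OF subgrp_gen, of v "[x3, x2, x1]"] card_gen_le[of "[x3, x2, x1]"]
    by (auto simp del: gen.simps)
  then have card_W: "card ?W = 8"
    using c4 card_gen[of v "[x3, x2, x1]"] gen_snoc[of "[x3, x2, x1]" v]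
    by (simp del: gen.simps)
  have WK: "?W \<subseteq> K i" using x1 x2 x3 by (intro gen_subset subgrp_K) auto
  have "sum defect ?W = sum defect (?W \<inter> {u})"
    using v \<open>v \<notin> ?W\<close> WK by (intro sum.mono_neutral_right finite_gen) auto
  also have "\<dots> \<in> {0, 2}" using du by (cases "u \<in> ?W") (auto simp del: gen.simps)
  finally show False
    using defect_8(2)[OF subgrp_gen subset_trans[OF WK KV] card_W] by (auto simp del: gen.simps)
qed

section \<open>The vectors in none of the ten subspaces\<close>

definition Z :: "'a set" where
  "Z = {u \<in> V. zeros u = 0}"

lemma Z_V: "z \<in> Z \<Longrightarrow> z \<in> V"
  by (simp add: Z_def)

lemma Z_neq_0: "z \<in> Z \<Longrightarrow> z \<noteq> 0"
  using zeros_0 by (auto simp: Z_def)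

lemma defect_Z: "z \<in> Z \<Longrightarrow> defect z = 3"
  using Z_neq_0 by (auto simp: Z_def defect_def)

lemma finite_Z: "finite Z"
  using finite_V by (simp add: Z_def)

text \<open>The first two moments of \<open>zeros\<close> are known: 160 = 10 * 16, and 520 = 10 *
  52 with 52 = 16 + 9 * 4. Since \<open>zeros\<close> takes only the values 0, 2, 3 away from 0,
  they determine how often 0 occurs.\<close>

lemma card_Z: "card Z = 8"
proof -
  have one: "(\<Sum>u\<in>V. zeros u) = 160"
    using sum_zeros[OF order_refl, of "\<lambda>_. 1"] K_structure(1)
    by (simp add: Int_absorb1 K_def)
  have "(\<Sum>u\<in>K i. zeros u) = 52" if "i < 10" for i
  proof -
    have "(\<Sum>u\<in>K i. zeros u) = (\<Sum>j<10. card (K i \<inter> K j))"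
      using sum_zeros[of "K i" "\<lambda>_. 1"] by (simp add: K_def)
    also have "\<dots> = card (K i \<inter> K i) + (\<Sum>j\<in>{..<10} - {i}. card (K i \<inter> K j))"
      using that by (intro sum.remove) auto
    also have "(\<Sum>j\<in>{..<10} - {i}. card (K i \<inter> K j)) = (\<Sum>j\<in>{..<10} - {i}. 4)"
      using K_structure(3) that by (intro sum.cong) auto
    finally show ?thesis using K_structure(1) that by simp
  qed
  moreover have "V \<inter> K i = K i" for i by (auto simp: K_def)
  ultimately have two: "(\<Sum>u\<in>V. zeros u * zeros u) = 520"
    using sum_zeros[OF order_refl, of zeros] by simp
  \<comment> \<open>The polynomial (z - 2)(z - 3) = z^2 - 5z + 6 vanishes at 2 and 3; it is 6 on
    \<open>Z\<close>, and 56 at the zero vector, where z = 10.\<close>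
  have "(\<Sum>u\<in>V. zeros u * zeros u + 6) =
      (\<Sum>u\<in>V. 5 * zeros u + (if u \<in> Z then 6 else 0) + (if u = 0 then 56 else 0))"
  proof (rule sum.cong)
    fix u assume u: "u \<in> V"
    show "zeros u * zeros u + 6 = 5 * zeros u + (if u \<in> Z then 6 else 0) + (if u = 0 then 56 else 0)"
    proof (cases "u = 0")
      case True
      then show ?thesis by (simp add: zeros_0 Z_def)
    next
      case False
      then have "zeros u \<in> {0, 2, 3}" using zeros_le[OF u] zeros_neq_1[OF u] by force
      then show ?thesis using u False by (auto simp: Z_def)
    qed
  qed simp
  moreover have "(\<Sum>u\<in>V. if u \<in> Z then 6 else 0) = 6 * card Z"
    using finite_V by (simp add: sum.If_cases Z_def Collect_conj_eq[symmetric] Int_def)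
  moreover have "(\<Sum>u\<in>V. if u = 0 then 56 else (0::nat)) = 56"
    using finite_V V(1) by (simp add: subgrp_def)
  ultimately show ?thesis
    using one two V(2) by (simp add: sum.distrib sum_distrib_left[symmetric])
qed

text \<open>Four vectors of defect 3 would exceed the bound 11 for a subgroup of order 8.\<close>

lemma Z_few_8:
  assumes "set xs \<subseteq> Z" "card (gen xs) = 8" "A \<subseteq> Z \<inter> gen xs"
  shows "card A \<le> 3"
proof -
  have "gen xs \<subseteq> V" using assms(1) Z_V by (intro gen_subset V) auto
  have "card A * 3 = sum defect A"
    using assms(3) defect_Z by (simp add: subset_iff)
  also have "\<dots> \<le> sum defect (gen xs)"
    using assms(3) finite_gen by (intro sum_mono2) auto
  finally show ?thesis using defect_8(1)[OF subgrp_gen \<open>gen xs \<subseteq> V\<close> assms(2)] by simp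
qed

text \<open>Otherwise p, q, p + q and any further t in \<open>Z\<close> would be four vectors of
  \<open>Z\<close> in a subgroup of order 8.\<close>

lemma Z_not_sum_2:
  assumes "p \<in> Z" "q \<in> Z" "p \<noteq> q"
  shows "p + q \<notin> Z"
proof
  assume r: "p + q \<in> Z"
  have "card {p, q, p + q} \<le> 3" by (simp add: card_insert_if)
  then have "\<not> Z \<subseteq> {p, q, p + q}"
    using card_mono[of "{p, q, p + q}" Z] card_Z by auto
  then obtain t where t: "t \<in> Z" "t \<noteq> p" "t \<noteq> q" "t \<noteq> p + q" by blast
  have "q \<notin> gen []" using Z_neq_0 assms by simp
  moreover have "p \<notin> gen [q]" using Z_neq_0 assms by auto
  moreover have "t \<notin> gen [p, q]" using Z_neq_0 t by auto
  ultimately have "card (gen [t, p, q]) = 8" by (simp add: card_gen del: gen.simps(2))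
  then have "card {p, q, p + q, t} \<le> 3"
    using r t(1) assms by (intro Z_few_8[of "[t, p, q]"]) auto
  moreover have "p \<noteq> p + q" "q \<noteq> p + q" using Z_neq_0 assms by auto
  ultimately show False using t assms by simp
qed

text \<open>A relation among the four would again put four vectors of \<open>Z\<close> into a
  subgroup of order 8. The conclusions are the conditions under which \<open>card_gen\<close> and
  \<open>sum_gen\<close> unfold \<open>gen [p, q, r, t]\<close>.\<close>

lemma Z_independent:
  assumes "distinct [p, q, r, t]" "set [p, q, r, t] \<subseteq> Z"
  shows "t \<notin> gen []" "r \<notin> gen [t]" "q \<notin> gen [r, t]" "p \<notin> gen [q, r, t]"
proof -
  show *: "t \<notin> gen []" "r \<notin> gen [t]" using assms Z_neq_0 by auto
  show **: "q \<notin> gen [r, t]" using assms Z_neq_0 Z_not_sum_2[of r t] by auto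
  show "p \<notin> gen [q, r, t]"
  proof
    assume p: "p \<in> gen [q, r, t]"
    have "card (gen [q, r, t]) = 8" using * ** by (simp add: card_gen del: gen.simps(2))
    then have "card {p, q, r, t} \<le> 3"
      using p assms by (intro Z_few_8[of "[q, r, t]"]) auto
    then show False using assms by simp
  qed
qed

text \<open>The four vectors contribute 12 to a total that is at most 15 and congruent to 3 mod 4,
  hence 15. The remaining 3 falls on the eleven sums of two or more of them.\<close>

lemma Z_quadruple:
  assumes "distinct [p, q, r, t]" "set [p, q, r, t] \<subseteq> Z"
  shows "card (gen [p, q, r, t]) = 16" "sum defect (gen [p, q, r, t]) = 15"
    "defect (p + q) + defect (p + r) + defect (p + t) + defect (q + r) + defect (q + t) +
     defect (r + t) + defect (p + (q + r)) + defect (p + (q + t)) + defect (p + (r + t)) +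
     defect (q + (r + t)) + defect (p + (q + (r + t))) = 3"
proof -
  note ind = Z_independent[OF assms]
  let ?R = "defect (p + q) + defect (p + r) + defect (p + t) + defect (q + r) + defect (q + t) +
     defect (r + t) + defect (p + (q + r)) + defect (p + (q + t)) + defect (p + (r + t)) +
     defect (q + (r + t)) + defect (p + (q + (r + t)))"
  have 16: "card (gen [p, q, r, t]) = 16"
    using ind by (simp add: card_gen del: gen.simps(2))
  have eq: "sum defect (gen [p, q, r, t]) = 12 + ?R"
    using ind assms by (simp add: sum_gen defect_Z del: gen.simps(2)) (simp add: defect_Z defect_def)
  have "gen [p, q, r, t] \<subseteq> V" using assms Z_V by (intro gen_subset V) auto
  then have "12 + ?R \<le> 15" "(12 + ?R) mod 4 = 3"
    using defect_16[OF subgrp_gen _ 16] unfolding eq by blast+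
  moreover have "R = 3" if "12 + R \<le> 15" "(12 + R) mod 4 = 3" for R :: nat
    using that by presburger
  ultimately show "?R = 3" by blast
  then show "sum defect (gen [p, q, r, t]) = 15" using eq by linarith
  show "card (gen [p, q, r, t]) = 16" by (rule 16)
qed

text \<open>The 256 subsets of \<open>Z\<close> have sums in a group of order 64, so three distinct
  subsets share a sum. The symmetric difference of two of them sums to zero, and one of the three
  symmetric differences is small.\<close>

lemma Z_dependence: "\<exists>D\<subseteq>Z. D \<noteq> {} \<and> card D \<le> 5 \<and> \<Sum>D = 0"
proof -
  have "(\<lambda>X. \<Sum>X) \<in> Pow Z \<rightarrow> V"
  proof
    fix X assume "X \<in> Pow Z"
    then have "X \<subseteq> Z" by simp
    then have "finite X" using finite_Z finite_subset by blast
    then show "\<Sum>X \<in> V" using \<open>X \<subseteq> Z\<close> V(1) Z_V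
      by (induction X) (auto simp: subgrp_def)
  qed
  from pigeonhole_card[OF this] finite_Z finite_V V
  obtain v where v: "card ((\<lambda>X. \<Sum>X) -` {v} \<inter> Pow Z) * 64 \<ge> 2 ^ 8"
    by (auto simp: subgrp_def card_Pow card_Z)
  then have "3 \<le> card ((\<lambda>X. \<Sum>X) -` {v} \<inter> Pow Z)" by simp
  then obtain F where F: "F \<subseteq> (\<lambda>X. \<Sum>X) -` {v} \<inter> Pow Z" "card F = 3"
    by (metis obtain_subset_with_card_n)
  then obtain A B C where "F = {A, B, C}" "A \<noteq> B" "A \<noteq> C" "B \<noteq> C"
    by (metis card_3_iff)
  with F have ABC: "A \<subseteq> Z" "B \<subseteq> Z" "C \<subseteq> Z" "\<Sum>A = v" "\<Sum>B = v" "\<Sum>C = v"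
    by auto
  have close: ?thesis if "X \<subseteq> Z" "Y \<subseteq> Z" "\<Sum>X = \<Sum>Y" "X \<noteq> Y" "card (X - Y \<union> (Y - X)) \<le> 5" for X Y
  proof -
    have fin: "finite X" "finite Y" using that finite_Z finite_subset by blast+
    have "\<Sum>X = \<Sum>(X - Y) + \<Sum>(X \<inter> Y)" "\<Sum>Y = \<Sum>(Y - X) + \<Sum>(X \<inter> Y)"
      using fin sum.subset_diff[of "X \<inter> Y" X "\<lambda>x. x"] sum.subset_diff[of "X \<inter> Y" Y "\<lambda>x. x"]
      by (simp_all add: Diff_Int)
    then have "\<Sum>(X - Y) = \<Sum>(Y - X)" using that(3) by simp
    moreover have "\<Sum>(X - Y \<union> (Y - X)) = \<Sum>(X - Y) + \<Sum>(Y - X)"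
      using fin by (intro sum.union_disjoint) auto
    ultimately have "\<Sum>(X - Y \<union> (Y - X)) = 0" by (simp add: double)
    then show ?thesis using that by (intro exI[of _ "X - Y \<union> (Y - X)"]) auto
  qed
  have card_sum: "card (X - Y \<union> (Y - X)) = (\<Sum>z\<in>Z. if z \<in> X \<longleftrightarrow> z \<in> Y then 0 else 1)"
    if "X \<subseteq> Z" "Y \<subseteq> Z" for X Y
  proof -
    have "X - Y \<union> (Y - X) = {z \<in> Z. \<not> (z \<in> X \<longleftrightarrow> z \<in> Y)}" using that by auto
    then show ?thesis using finite_Z by (simp add: sum.If_cases Int_def)
  qed
  \<comment> \<open>Each element lies in at most two of the three symmetric differences, so their
    sizes add up to at most 16 and one of them is at most 5.\<close>
  have "card (A - B \<union> (B - A)) + card (A - C \<union> (C - A)) + card (B - C \<union> (C - B)) \<le> (\<Sum>z\<in>Z. 2)"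
    unfolding card_sum[OF ABC(1,2)] card_sum[OF ABC(1,3)] card_sum[OF ABC(2,3)] sum.distrib[symmetric]
    by (rule sum_mono) auto
  then have "card (A - B \<union> (B - A)) \<le> 5 \<or> card (A - C \<union> (C - A)) \<le> 5 \<or> card (B - C \<union> (C - B)) \<le> 5"
    using card_Z by auto
  then show ?thesis
    using close[of A B] close[of A C] close[of B C] ABC \<open>A \<noteq> B\<close> \<open>A \<noteq> C\<close> \<open>B \<noteq> C\<close> by metis
qed

text \<open>A nonempty set of at most five vectors of \<open>Z\<close> with sum zero must have
  exactly five, because any four are independent. One of them is written as the sum of the
  others.\<close>

lemma Z_five:
  obtains b c d e where "distinct [b + (c + (d + e)), b, c, d, e]"
    "set [b + (c + (d + e)), b, c, d, e] \<subseteq> Z"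
proof -
  obtain D where D: "D \<subseteq> Z" "D \<noteq> {}" "card D \<le> 5" "\<Sum>D = 0" using Z_dependence by blast
  have "finite D" using D(1) finite_Z finite_subset by blast
  then obtain xs where xs: "set xs = D" "distinct xs" using finite_distinct_list by blast
  then have len: "length xs \<le> 5" "xs \<noteq> []" "set xs \<subseteq> Z" "sum_list xs = 0"
    using D distinct_card[of xs] sum_list_distinct_conv_sum_set[of xs "\<lambda>x. x"] by auto
  have n1: "length xs \<noteq> 1" using len Z_neq_0 by (auto simp: length_Suc_conv)
  have n2: "length xs \<noteq> 2" using len xs(2) by (auto simp: numeral_2_eq_2 length_Suc_conv add_eq_0)
  have n3: "length xs \<noteq> 3"
    using len xs(2) Z_not_sum_2 by (auto simp: numeral_3_eq_3 length_Suc_conv add_eq_0)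
  have n4: "length xs \<noteq> 4"
  proof
    assume "length xs = 4"
    then obtain p q r t where eq: "xs = [p, q, r, t]"
      by (auto simp: eval_nat_numeral length_Suc_conv)
    then have "p \<in> gen [q, r, t]" using len(4) by (simp add: add_eq_0)
    then show False using Z_independent(4)[of p q r t] xs(2) len(3) unfolding eq by blast
  qed
  from n1 n2 n3 n4 len(1,2) have "length xs = 5" by (cases "length xs") auto
  then obtain a b c d e where eq: "xs = [a, b, c, d, e]"
    by (auto simp: eval_nat_numeral length_Suc_conv)
  then have "a = b + (c + (d + e))" using len(4) by (simp add: add_eq_0)
  then show thesis using that[of b c d e] xs(2) len(3) unfolding eq by blast
qed

text \<open>The weights for \<open>triple_weights\<close> are the defects of x + p for the five
  vectors p, and of x + p + q for the pairs. As the five sum to zero, x + p + q + r is the sum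
  belonging to the complementary pair.\<close>

lemma Z_five_shift:
  assumes dist: "distinct [x, b + (c + (d + e)), b, c, d, e]"
    and Z: "set [x, b + (c + (d + e)), b, c, d, e] \<subseteq> Z"
  shows "defect (x + b) = 1 \<and> defect (x + e) = 1"
proof -
  let ?a = "b + (c + (d + e))"
  let ?U = "gen [b, c, d, e]"
  have bcde: "distinct [b, c, d, e]" "set [b, c, d, e] \<subseteq> Z" using dist Z by auto
  note quad = Z_quadruple[OF bcde]
  have "defect ?a = 3" using Z by (intro defect_Z) simp
  \<comment> \<open>The sum of all four vectors is \<open>?a\<close>, which absorbs the whole
    remaining defect 3.\<close>
  then have D0: "defect (b + c) = 0" "defect (b + d) = 0" "defect (b + e) = 0"
     "defect (c + d) = 0" "defect (c + e) = 0" "defect (d + e) = 0" "defect (b + (c + d)) = 0"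
     "defect (b + (c + e)) = 0" "defect (b + (d + e)) = 0" "defect (c + (d + e)) = 0"
    using quad(3) by simp_all
  have x: "defect x = 3" "x \<noteq> 0" using Z by (simp_all add: defect_Z Z_neq_0)
  have xU: "x \<notin> ?U"
  proof
    assume "x \<in> ?U"
    then consider "x = 0" | "x \<in> {?a, b, c, d, e}" | "defect x = 0"
      using D0 by (auto simp del: add_0_left)
    then show False using x dist by cases auto
  qed
  have "card (gen [x, b, c, d, e]) = 32" using xU quad(1) by (simp add: card_gen del: gen.simps(2))
  moreover have "gen [x, b, c, d, e] \<subseteq> V" using Z Z_V by (intro gen_subset V) auto
  ultimately have "sum defect (gen [x, b, c, d, e]) \<le> 23" by (intro defect_32 subgrp_gen)
  \<comment> \<open>Of at most 23, the subgroup \<open>?U\<close> takes 15 and leaves 8 for its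
    coset. Of these x takes 3, so 5 remain for the points and pairs.\<close>
  then have "(\<Sum>u\<in>?U. defect (x + u)) \<le> 8"
    using quad(2) unfolding sum_gen[OF xU] sum.distrib by linarith
  then have total: "defect (x + b) + defect (x + c) + defect (x + d) + defect (x + e) +
      defect (x + (b + c)) + defect (x + (b + d)) + defect (x + (b + e)) +
      defect (x + (c + d)) + defect (x + (c + e)) + defect (x + (d + e)) +
      defect (x + (b + (c + d))) + defect (x + (b + (c + e))) + defect (x + (b + (d + e))) +
      defect (x + (c + (d + e))) + defect (x + ?a) \<le> 5"
    using Z_independent[OF bcde] x by (simp add: sum_gen del: gen.simps(2))
  \<comment> \<open>Each triple of the five vectors is completed by x to a quadruple in
    \<open>Z\<close>. The sums without x then have defect 0 by \<open>D0\<close>, which leaves seven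
    terms.\<close>
  have q: "defect (x + p) + defect (x + q) + defect (x + r) + defect (p + q) + defect (p + r) +
     defect (q + r) + defect (x + (p + q)) + defect (x + (p + r)) + defect (x + (q + r)) +
     defect (p + (q + r)) + defect (x + (p + (q + r))) = 3"
    if "distinct [p, q, r]" "{p, q, r} \<subseteq> {?a, b, c, d, e}" for p q r
    using that dist Z by (intro Z_quadruple(3)) auto
  have "b \<noteq> ?a" "c \<noteq> ?a" "d \<noteq> ?a" "e \<noteq> ?a" using dist by auto
  then have
    "defect (x + b) + defect (x + c) + defect (x + d) + defect (x + (b + c)) + defect (x + (b + d)) +
      defect (x + (c + d)) + defect (x + (b + (c + d))) = 3"
    "defect (x + b) + defect (x + c) + defect (x + e) + defect (x + (b + c)) + defect (x + (b + e)) +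
      defect (x + (c + e)) + defect (x + (b + (c + e))) = 3"
    "defect (x + b) + defect (x + d) + defect (x + e) + defect (x + (b + d)) + defect (x + (b + e)) +
      defect (x + (d + e)) + defect (x + (b + (d + e))) = 3"
    "defect (x + c) + defect (x + d) + defect (x + e) + defect (x + (c + d)) + defect (x + (c + e)) +
      defect (x + (d + e)) + defect (x + (c + (d + e))) = 3"
    using q[of b c d] q[of b c e] q[of b d e] q[of c d e] dist by (simp_all add: D0)
  moreover have
    "defect (x + ?a) + defect (x + b) + defect (x + c) + defect (x + (c + (d + e))) +
      defect (x + (b + (d + e))) + defect (x + (b + c)) + defect (x + (d + e)) = 3"
    "defect (x + ?a) + defect (x + b) + defect (x + d) + defect (x + (c + (d + e))) +
      defect (x + (b + (c + e))) + defect (x + (b + d)) + defect (x + (c + e)) = 3"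
    "defect (x + ?a) + defect (x + b) + defect (x + e) + defect (x + (c + (d + e))) +
      defect (x + (b + (c + d))) + defect (x + (b + e)) + defect (x + (c + d)) = 3"
    "defect (x + ?a) + defect (x + c) + defect (x + d) + defect (x + (b + (d + e))) +
      defect (x + (b + (c + e))) + defect (x + (c + d)) + defect (x + (b + e)) = 3"
    "defect (x + ?a) + defect (x + c) + defect (x + e) + defect (x + (b + (d + e))) +
      defect (x + (b + (c + d))) + defect (x + (c + e)) + defect (x + (b + d)) = 3"
    "defect (x + ?a) + defect (x + d) + defect (x + e) + defect (x + (b + (c + e))) +
      defect (x + (b + (c + d))) + defect (x + (d + e)) + defect (x + (b + c)) = 3"
  proof -
    have s: "?a + b = c + (d + e)" "?a + c = b + (d + e)" "?a + d = b + (c + e)" "?a + e = b + (c + d)"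
      "?a + (b + c) = d + e" "?a + (b + d) = c + e" "?a + (b + e) = c + d"
      "?a + (c + d) = b + e" "?a + (c + e) = b + d" "?a + (d + e) = b + c"
      by (simp_all add: double_simps)
    show
    "defect (x + ?a) + defect (x + b) + defect (x + c) + defect (x + (c + (d + e))) +
      defect (x + (b + (d + e))) + defect (x + (b + c)) + defect (x + (d + e)) = 3"
      using q[of ?a b c] dist unfolding s by (simp add: D0)
    show
    "defect (x + ?a) + defect (x + b) + defect (x + d) + defect (x + (c + (d + e))) +
      defect (x + (b + (c + e))) + defect (x + (b + d)) + defect (x + (c + e)) = 3"
      using q[of ?a b d] dist unfolding s by (simp add: D0)
    show
    "defect (x + ?a) + defect (x + b) + defect (x + e) + defect (x + (c + (d + e))) +
      defect (x + (b + (c + d))) + defect (x + (b + e)) + defect (x + (c + d)) = 3"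
      using q[of ?a b e] dist unfolding s by (simp add: D0)
    show
    "defect (x + ?a) + defect (x + c) + defect (x + d) + defect (x + (b + (d + e))) +
      defect (x + (b + (c + e))) + defect (x + (c + d)) + defect (x + (b + e)) = 3"
      using q[of ?a c d] dist unfolding s by (simp add: D0)
    show
    "defect (x + ?a) + defect (x + c) + defect (x + e) + defect (x + (b + (d + e))) +
      defect (x + (b + (c + d))) + defect (x + (c + e)) + defect (x + (b + d)) = 3"
      using q[of ?a c e] dist unfolding s by (simp add: D0)
    show
    "defect (x + ?a) + defect (x + d) + defect (x + e) + defect (x + (b + (c + e))) +
      defect (x + (b + (c + d))) + defect (x + (d + e)) + defect (x + (b + c)) = 3"
      using q[of ?a d e] dist unfolding s by (simp add: D0)
  qed
  ultimately show ?thesis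
    using total
    by (intro triple_weights[where a = "defect (x + ?a)" and b = "defect (x + b)" and c = "defect (x + c)"
          and d = "defect (x + d)" and e = "defect (x + e)"
          and ab = "defect (x + (c + (d + e)))" and ac = "defect (x + (b + (d + e)))"
          and ad = "defect (x + (b + (c + e)))" and ae = "defect (x + (b + (c + d)))"
          and bc = "defect (x + (b + c))" and bd = "defect (x + (b + d))"
          and be = "defect (x + (b + e))" and cd = "defect (x + (c + d))"
          and ce = "defect (x + (c + e))" and de = "defect (x + (d + e))"]) (simp_all only: add_ac)
qed

lemma contradiction: False
proof -
  obtain b c d e where five: "distinct [b + (c + (d + e)), b, c, d, e]"
    "set [b + (c + (d + e)), b, c, d, e] \<subseteq> Z" using Z_five by blast
  let ?D = "set [b + (c + (d + e)), b, c, d, e]"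
  have "card (Z - ?D) = 3"
    using five distinct_card[OF five(1)] card_Z by (subst card_Diff_subset) auto
  then obtain x y z where xyz: "Z - ?D = {x, y, z}" "x \<noteq> y" by (metis card_3_iff)
  have x: "x \<in> Z" "x \<notin> ?D" and y: "y \<in> Z" "y \<notin> ?D" using xyz(1) by blast+
  have "defect (x + b) = 1 \<and> defect (x + e) = 1"
    using five x by (intro Z_five_shift[of x b c d e]) auto
  moreover have "defect (y + b) = 1 \<and> defect (y + e) = 1"
    using five y by (intro Z_five_shift[of y b c d e]) auto
  \<comment> \<open>The four sums of x or y with b or e have defect 1 each, but the quadruple x, y,
    b, e allows only 3 in total.\<close>
  ultimately show False
    using Z_quadruple(3)[of x y b e] x y xyz(2) five by simp
qed

end

section \<open>The Griesmer bound\<close>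

text \<open>The sum of d / 2^i, rounded up, over i < k.\<close>

fun griesmer :: "nat \<Rightarrow> nat \<Rightarrow> nat" where
  "griesmer 0 d = 0"
| "griesmer (Suc k) d = d + griesmer k ((d + 1) div 2)"

text \<open>Binary codewords are represented by their supports, with symmetric difference as
  addition. Deleting the support c of a word of minimum weight leaves the residual code, with half
  as many words and at least half the minimum weight.\<close>

lemma griesmer_bound:
  fixes C :: "'b set set"
  assumes "finite (\<Union>C)" "card C = 2 ^ k"
    and "\<And>A B. A \<in> C \<Longrightarrow> B \<in> C \<Longrightarrow> (A - B) \<union> (B - A) \<in> C"
    and "\<And>A. A \<in> C \<Longrightarrow> A \<noteq> {} \<Longrightarrow> d \<le> card A"
  shows "griesmer k d \<le> card (\<Union>C)"
  using assms
proof (induction k arbitrary: C d)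
  case (Suc k)
  note closed = Suc.prems(3)
  have fin: "finite A" if "A \<in> C" for A
    using Suc.prems(1) that by (meson Sup_upper finite_subset)
  have finC: "finite C" using Suc.prems(2) card.infinite by fastforce
  have "1 < card C"
    unfolding Suc.prems(2) by (rule one_less_power) auto
  then have "\<not> C \<subseteq> {{}}"
    using card_mono[of "{{}}" C] by auto
  then obtain c0 where "c0 \<in> C \<and> c0 \<noteq> {}" by blast
  then obtain c where c: "c \<in> C" "c \<noteq> {}" and least: "\<And>A. A \<in> C \<Longrightarrow> A \<noteq> {} \<Longrightarrow> card c \<le> card A"
    using ex_has_least_nat[of "\<lambda>A. A \<in> C \<and> A \<noteq> {}" c0 card] by blast
  let ?r = "\<lambda>A. A - c"
  let ?C = "?r ` C"
  \<comment> \<open>Two words that agree outside c differ by a word supported in c, which by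
    minimality is empty or c itself.\<close>
  have fibre: "{B \<in> C. ?r B = ?r A} = {A, (A - c) \<union> (c - A)}" if A: "A \<in> C" for A
  proof (intro equalityI subsetI)
    fix B assume "B \<in> {B \<in> C. ?r B = ?r A}"
    then have B: "B \<in> C" "?r B = ?r A" by auto
    let ?D = "(A - B) \<union> (B - A)"
    have "?D \<subseteq> c" using B(2) by auto
    moreover have "?D = {} \<or> card c \<le> card ?D" using least closed A B(1) by blast
    ultimately have "?D = {} \<or> ?D = c"
      using fin c(1) card_seteq[of c ?D] by blast
    then show "B \<in> {A, (A - c) \<union> (c - A)}" by blast
  qed (use closed A c in auto)
  have "card C = (\<Sum>y\<in>?C. \<Sum>A\<in>{A \<in> C. ?r A = y}. 1)"
    using sum.image_gen[OF finC, of "\<lambda>_. 1::nat" ?r] by simp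
  also have "\<dots> = (\<Sum>y\<in>?C. 2)"
  proof (rule sum.cong)
    fix y assume "y \<in> ?C"
    then obtain A where A: "A \<in> C" "y = ?r A" by blast
    have "A \<noteq> (A - c) \<union> (c - A)" using c(2) by blast
    then show "(\<Sum>A\<in>{A \<in> C. ?r A = y}. 1) = (2::nat)"
      unfolding A(2) fibre[OF A(1)] by simp
  qed simp
  finally have card: "card ?C = 2 ^ k" using Suc.prems(2) by simp
  \<comment> \<open>Both A and its symmetric difference with c weigh at least as much as c. Adding
    the two inequalities, the parts inside c sum to the weight of c.\<close>
  have half: "(d + 1) div 2 \<le> card B" if "B \<in> ?C" "B \<noteq> {}" for B
  proof -
    obtain A where A: "A \<in> C" "B = A - c" using \<open>B \<in> ?C\<close> by blast
    have "card c \<le> card A" using least A that(2) by blast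
    also have "card A = card (A - c) + card (A \<inter> c)"
      using fin[OF A(1)] by (subst card_Un_disjoint[symmetric]) (auto intro: arg_cong[where f = card])
    finally have "card c \<le> card (A - c) + card (A \<inter> c)" .
    moreover have "card c \<le> card ((A - c) \<union> (c - A))"
      using least[OF closed[OF A(1) c(1)]] A that(2) by blast
    then have "card c \<le> card (A - c) + card (c - A)"
      using card_Un_le le_trans by blast
    moreover have "card (c - A) + card (A \<inter> c) = card c"
      using fin[OF c(1)] by (subst card_Un_disjoint[symmetric]) (auto intro: arg_cong[where f = card])
    ultimately have "card c \<le> 2 * card (A - c)" by linarith
    moreover have "d \<le> card c" using Suc.prems(4) c by blast
    ultimately have "d \<le> 2 * card (A - c)" by (rule order_trans[rotated])
    then have "d + 1 < Suc (card (A - c)) * 2" by simp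
    then show ?thesis using A(2) less_mult_imp_div_less less_Suc_eq_le by metis
  qed
  have "\<Union>?C \<subseteq> \<Union>C - c" by blast
  then have "finite (\<Union>?C)" and le: "card (\<Union>?C) \<le> card (\<Union>C - c)"
    using Suc.prems(1) finite_subset card_mono by (metis finite_Diff)+
  have closed': "(A - B) \<union> (B - A) \<in> ?C" if AB: "A \<in> ?C" "B \<in> ?C" for A B
  proof -
    obtain A' B' where "A' \<in> C" "B' \<in> C" "A = A' - c" "B = B' - c" using AB by blast
    then show ?thesis using closed[of A' B'] by (intro image_eqI[of _ _ "(A' - B') \<union> (B' - A')"]) auto
  qed
  have "griesmer k ((d + 1) div 2) \<le> card (\<Union>?C)"
    by (rule Suc.IH[OF \<open>finite (\<Union>?C)\<close> card closed' half])
  moreover have "card (\<Union>C - c) + card c = card (\<Union>C)"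
    using Suc.prems(1) c(1) fin[OF c(1)] by (metis Sup_upper card_Diff_subset card_mono le_add_diff_inverse2)
  moreover have "d \<le> card c" using Suc.prems(4) c by blast
  ultimately show ?case using le by simp
qed simp

section \<open>Cardinalities of spaces of words\<close>

lemma finite_words: "finite (UNIV :: 'a::zero set) \<Longrightarrow> finite (words n :: (nat \<Rightarrow> 'a) set)"
proof (rule finite_subset)
  show "words n \<subseteq> {x :: nat \<Rightarrow> 'a. \<forall>i. (i \<in> {..<n} \<longrightarrow> x i \<in> UNIV) \<and> (i \<notin> {..<n} \<longrightarrow> x i = 0)}"
    by (auto simp: words_def)
  show "finite {x :: nat \<Rightarrow> 'a. \<forall>i. (i \<in> {..<n} \<longrightarrow> x i \<in> UNIV) \<and> (i \<notin> {..<n} \<longrightarrow> x i = 0)}"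
    if "finite (UNIV :: 'a set)"
    using that by (intro finite_set_of_finite_funs) auto
qed

text \<open>Adjoining b multiplies the order by that of the field, since (k, y) determines k b + y
  bijectively.\<close>

lemma card_span_independent:
  fixes B :: "(nat \<Rightarrow> 'a::field) set"
  assumes "finite (UNIV :: 'a set)" "finite B" "word.independent B"
  shows "card (word.span B) = CARD('a) ^ card B"
  using assms(2,3)
proof (induction B rule: finite_induct)
  case (insert b B)
  have b: "b \<notin> word.span B" and B: "word.independent B"
    using insert.prems insert.hyps(2) by (auto simp: word.independent_insert)
  have sub: "word.subspace (word.span B)" by (rule word.subspace_span)
  let ?h = "\<lambda>(k, y). word_scale k b + y"
  have img: "word.span (insert b B) = ?h ` (UNIV \<times> word.span B)"
  proof (intro equalityI subsetI)
    fix x assume "x \<in> word.span (insert b B)"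
    then obtain k where "x - word_scale k b \<in> word.span B" by (auto simp: word.span_insert)
    then show "x \<in> ?h ` (UNIV \<times> word.span B)"
      by (intro image_eqI[of _ _ "(k, x - word_scale k b)"]) auto
  next
    fix x assume "x \<in> ?h ` (UNIV \<times> word.span B)"
    then obtain k y where "y \<in> word.span B" "x = word_scale k b + y" by auto
    then have "x - word_scale k b \<in> word.span B" by simp
    then show "x \<in> word.span (insert b B)" unfolding word.span_insert by blast
  qed
  have inj: "inj_on ?h (UNIV \<times> word.span B)"
  proof (rule inj_onI, clarify)
    fix k y l z assume yz: "y \<in> word.span B" "z \<in> word.span B"
      and eq: "word_scale k b + y = word_scale l b + z"
    have "word_scale (k - l) b = z - y"
      using eq by (simp add: word.scale_left_diff_distrib algebra_simps)
    then have m: "word_scale (k - l) b \<in> word.span B"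
      using yz word.span_diff by metis
    have "k = l"
    proof (rule ccontr)
      assume "k \<noteq> l"
      then have "word_scale (inverse (k - l)) (word_scale (k - l) b) = b" by simp
      then show False using m b word.span_scale by metis
    qed
    then show "k = l \<and> y = z" using eq by simp
  qed
  show ?case
    using insert.IH[OF B] insert.hyps
    unfolding img by (simp add: card_image[OF inj] card_cartesian_product)
qed simp

lemma card_subspace:
  fixes S :: "(nat \<Rightarrow> 'a::field) set"
  assumes "finite (UNIV :: 'a set)" "finite S" "word.subspace S"
  shows "card S = CARD('a) ^ word.dim S"
proof -
  obtain B where B: "B \<subseteq> S" "word.independent B" "S \<subseteq> word.span B" "card B = word.dim S"
    using word.basis_exists by blast
  have "word.span B = S" using B assms(3) by (metis word.span_minimal subset_antisym)
  then show ?thesis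
    using card_span_independent[OF assms(1) finite_subset[OF B(1) assms(2)] B(2)] B(4) by simp
qed

lemma finite_distances:
  "finite {hamming_dist n x y | x y. x \<in> D \<and> y \<in> D \<and> x \<noteq> y}"
proof (rule finite_subset)
  show "{hamming_dist n x y | x y. x \<in> D \<and> y \<in> D \<and> x \<noteq> y} \<subseteq> {..n}"
  proof clarsimp
    fix x y :: "nat \<Rightarrow> 'b"
    have "card {i. i < n \<and> x i \<noteq> y i} \<le> card {..<n}" by (rule card_mono) auto
    then show "hamming_dist n x y \<le> n" by (simp add: hamming_dist_def)
  qed
qed simp

section \<open>From additive codes to binary codes of three times the length\<close>

lemma bit_UNIV: "(UNIV :: bit set) = {0, 1}"
  using bit_not_zero_iff by auto

lemma card_bit: "CARD(bit) = 2" "finite (UNIV :: bit set)"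
  by (simp_all add: bit_UNIV)

lemma bit_double: "x + x = (0 :: bit)"
  by (cases x) auto

lemma pair_symbols_eq_iff:
  "pair_symbols x i = pair_symbols y i \<longleftrightarrow> pair_symbols (x + y) i = (0, 0)"
  by (cases "x (2 * i)"; cases "y (2 * i)"; cases "x (2 * i + 1)"; cases "y (2 * i + 1)")
    (simp_all add: pair_symbols_def)

lemma hamming_dist_pair_symbols:
  "hamming_dist n (pair_symbols x) (pair_symbols y) = card {i. i < n \<and> pair_symbols (x + y) i \<noteq> (0, 0)}"
  unfolding hamming_dist_def pair_symbols_eq_iff ..

text \<open>Over the field with two elements a difference is a sum, so distances become weights; the
  dimension 2 * 3 becomes the order 64.\<close>

lemma additive_lengthsE:
  assumes "n \<in> additive_lengths 3 s"
  obtains d C where "n = d + s" "0 < d" "C \<subseteq> words (2 * n)" "word.subspace C" "card C = 64"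
    and "\<And>x. x \<in> C \<Longrightarrow> x \<noteq> 0 \<Longrightarrow> d \<le> card {i. i < n \<and> pair_symbols x i \<noteq> (0, 0)}"
proof -
  obtain d C where "additive_code n 3 d C" and n: "n = d + s"
    using assms unfolding additive_lengths_def by blast
  then have C: "C \<subseteq> words (2 * n)" "word.subspace C" "of_nat (word.dim C) = (2 * 3 :: rat)"
      and d: "min_distance n (pair_symbols ` C) = d"
    unfolding additive_code_def by blast+
  have "finite C" using C(1) finite_words[OF card_bit(2)] finite_subset by blast
  moreover have "word.dim C = 6" using C(3) by linarith
  ultimately have card: "card C = 64"
    using card_subspace[OF card_bit(2)] C(2) by (simp add: card_bit)
  let ?H = "{hamming_dist n x y | x y. x \<in> pair_symbols ` C \<and> y \<in> pair_symbols ` C \<and> x \<noteq> y}"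
  have dist: "hamming_dist n (pair_symbols x) (pair_symbols y) \<in> ?H" if "x \<in> C" "y \<in> C" "x \<noteq> y" for x y
    using that injD[OF inj_pair_symbols, of x y] by blast
  have weight: "d \<le> card {i. i < n \<and> pair_symbols x i \<noteq> (0, 0)}" if "x \<in> C" "x \<noteq> 0" for x
  proof -
    have "d \<le> hamming_dist n (pair_symbols x) (pair_symbols 0)"
      unfolding d[symmetric] min_distance_def
      using that word.subspace_0[OF C(2)] by (intro Min_le finite_distances dist) auto
    then show ?thesis by (simp add: hamming_dist_pair_symbols)
  qed
  have "\<not> C \<subseteq> {0}"
    using card_mono[of "{0}" C] card by auto
  then obtain x0 where "x0 \<in> C" "x0 \<noteq> 0" by blast
  from dist[OF this(1) word.subspace_0[OF C(2)] this(2)] have "?H \<noteq> {}" by (metis empty_iff)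
  then have "d \<in> ?H"
    unfolding d[symmetric] min_distance_def by (intro Min_in finite_distances)
  then obtain x y where xy: "x \<in> C" "y \<in> C" "x \<noteq> y" "d = hamming_dist n (pair_symbols x) (pair_symbols y)"
    by auto
  \<comment> \<open>The minimum is attained by distinct codewords; both vanish beyond the length, so
    they differ at a counted symbol and d is positive.\<close>
  have "\<exists>i<n. pair_symbols x i \<noteq> pair_symbols y i"
  proof (rule ccontr)
    assume same: "\<not> (\<exists>i<n. pair_symbols x i \<noteq> pair_symbols y i)"
    have "pair_symbols x i = pair_symbols y i" for i
    proof (cases "i < n")
      case False
      moreover have "x \<in> words (2 * n)" "y \<in> words (2 * n)" using xy(1,2) C(1) by auto
      ultimately show ?thesis by (simp add: pair_symbols_def words_def)
    qed (use same in blast)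
    then have "pair_symbols x = pair_symbols y" by (rule ext)
    then show False using xy(3) injD[OF inj_pair_symbols] by blast
  qed
  then have "0 < d" unfolding xy(4) hamming_dist_def by (auto simp: card_gt_0_iff)
  then show thesis using that[OF n _ C(1,2) card weight] by blast
qed

text \<open>The support of the word in which each symbol (a, b) is replaced by (a, b, a + b): a
  position is a coordinate together with a nonzero linear functional p.\<close>

definition simplex_support :: "nat \<Rightarrow> (nat \<Rightarrow> bit) \<Rightarrow> (nat \<times> bit \<times> bit) set" where
  "simplex_support n x = {(i, p). i < n \<and> p \<noteq> (0, 0) \<and>
     fst p * x (2 * i) + snd p * x (2 * i + 1) = 1}"

lemma simplex_support_add:
  "simplex_support n (x + y) =
     (simplex_support n x - simplex_support n y) \<union> (simplex_support n y - simplex_support n x)"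
proof -
  have xor: "p * (x i + y i) + q * (x j + y j) = 1 \<longleftrightarrow>
    (p * x i + q * x j = 1) \<noteq> (p * y i + q * y j = 1)" for p q :: bit and i j
    by (cases p; cases q; cases "x i"; cases "y i"; cases "x j"; cases "y j") simp_all
  have "(i, p, q) \<in> simplex_support n (x + y) \<longleftrightarrow>
    (i, p, q) \<in> simplex_support n x - simplex_support n y \<union> (simplex_support n y - simplex_support n x)"
    for i p q
    unfolding simplex_support_def Un_iff Diff_iff mem_Collect_eq case_prod_conv fst_conv snd_conv
      plus_fun_apply xor
    by blast
  then show ?thesis by (simp only: set_eq_iff split_paired_All) blast
qed

text \<open>A nonzero symbol takes the value 1 under exactly two of the three nonzero
  functionals.\<close>

lemma card_simplex_support:
  "card (simplex_support n x) = 2 * card {i. i < n \<and> pair_symbols x i \<noteq> (0, 0)}"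
proof -
  let ?P = "\<lambda>a b. {p :: bit \<times> bit. p \<noteq> (0, 0) \<and> fst p * a + snd p * b = 1}"
  have P: "?P 0 0 = {}" "?P 1 0 = {(1, 0), (1, 1)}" "?P 0 1 = {(0, 1), (1, 1)}" "?P 1 1 = {(1, 0), (0, 1)}"
    by (auto simp: bit_not_zero_iff)
  have card_P: "card (?P a b) = (if (a, b) = (0, 0) then 0 else 2)" for a b
  proof -
    have "(a = 0 \<or> a = 1) \<and> (b = 0 \<or> b = 1)" using bit_not_zero_iff by blast
    then show ?thesis by (elim conjE disjE) (simp_all only: P, simp_all)
  qed
  have "simplex_support n x = Sigma {..<n} (\<lambda>i. ?P (x (2 * i)) (x (2 * i + 1)))"
    by (auto simp: simplex_support_def)
  then have "card (simplex_support n x) = (\<Sum>i<n. card (?P (x (2 * i)) (x (2 * i + 1))))"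
    by (simp add: card_SigmaI finite_subset[OF subset_UNIV] finite_prod card_bit flip: UNIV_Times_UNIV)
  also have "\<dots> = (\<Sum>i<n. if pair_symbols x i = (0, 0) then 0 else 2)"
    unfolding card_P pair_symbols_def ..
  also have "\<dots> = 2 * card {i. i < n \<and> pair_symbols x i \<noteq> (0, 0)}"
  proof -
    have "{i. i < n \<and> pair_symbols x i \<noteq> (0, 0)} = {..<n} \<inter> - {i. pair_symbols x i = (0, 0)}"
      by blast
    then show ?thesis by (simp add: sum.If_cases)
  qed
  finally show ?thesis .
qed

text \<open>The supports form a binary code of dimension 6 on at most 3n positions, with all nonzero
  weights at least 2d; in particular, no two codewords share a support.\<close>

lemma additive_griesmer:
  assumes "n \<in> additive_lengths 3 s"
  obtains d where "n = d + s" "0 < d" "griesmer 6 (2 * d) \<le> 3 * n"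
proof -
  obtain d C where C: "n = d + s" "0 < d" "C \<subseteq> words (2 * n)" "word.subspace C" "card C = 64"
    and weight: "\<And>x. x \<in> C \<Longrightarrow> x \<noteq> 0 \<Longrightarrow> d \<le> card {i. i < n \<and> pair_symbols x i \<noteq> (0, 0)}"
    using additive_lengthsE[OF assms] by blast
  let ?S = "simplex_support n ` C"
  have heavy: "2 * d \<le> card (simplex_support n x)" if "x \<in> C" "x \<noteq> 0" for x
    using weight[OF that] by (simp add: card_simplex_support)
  have "inj_on (simplex_support n) C"
  proof (rule inj_onI, rule ccontr)
    fix x y assume xy: "x \<in> C" "y \<in> C" "simplex_support n x = simplex_support n y" "x \<noteq> y"
    then have "simplex_support n (x + y) = {}" by (simp add: simplex_support_add)
    moreover have "x + y \<noteq> 0"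
    proof
      assume "x + y = 0"
      then have "x i + y i = 0" for i by (simp add: fun_eq_iff)
      then have "x i = y i" for i by (cases "x i"; cases "y i") (metis add_0_left add_0_right)+
      then show False using xy(4) by auto
    qed
    ultimately show False
      using heavy[of "x + y"] word.subspace_add[OF C(4)] xy(1,2) C(2) by simp
  qed
  then have card: "card ?S = 2 ^ 6" using C(5) by (simp add: card_image)
  have sub: "\<Union>?S \<subseteq> {..<n} \<times> (UNIV - {(0, 0)})" by (auto simp: simplex_support_def)
  have fin: "finite ({..<n} \<times> (UNIV - {(0, 0)} :: (bit \<times> bit) set))"
    by (simp add: finite_prod card_bit)
  have "card (UNIV - {(0, 0)} :: (bit \<times> bit) set) = 3"
    by (subst card_Diff_subset) (simp_all add: card_prod card_bit)
  then have "card (\<Union>?S) \<le> n * 3"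
    using card_mono[OF fin sub] by (simp add: card_cartesian_product)
  moreover have "griesmer 6 (2 * d) \<le> card (\<Union>?S)"
  proof (rule griesmer_bound[OF finite_subset[OF sub fin] card])
    fix A B assume "A \<in> ?S" "B \<in> ?S"
    then show "(A - B) \<union> (B - A) \<in> ?S"
      using word.subspace_add[OF C(4)] by (auto simp flip: simplex_support_add)
  next
    fix A assume "A \<in> ?S" "A \<noteq> {}"
    then obtain x where "x \<in> C" "A = simplex_support n x" by blast
    moreover have "simplex_support n 0 = {}" by (simp add: simplex_support_def)
    ultimately show "2 * d \<le> card A" using heavy \<open>A \<noteq> {}\<close> by blast
  qed
  ultimately show thesis using that[of d] C(1,2) by simp
qed

text \<open>The first two Griesmer terms 2d and d cancel against 3d, so the other four, d/2, d/4,
  d/8 and d/16 rounded up, sum to at most 3s. Solving for d gives one bound for each residue of s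
  mod 5.\<close>

lemma griesmer_6:
  assumes "0 < d" "griesmer 6 (2 * d) \<le> 3 * (d + s)"
  shows "2 \<le> s" "d + s \<le> 21 * (s div 5) + [0, 1, 6, 11, 16] ! (s mod 5)"
proof -
  define e1 where "e1 = (d + 1) div 2"
  define e2 where "e2 = (e1 + 1) div 2"
  define e3 where "e3 = (e2 + 1) div 2"
  define e4 where "e4 = (e3 + 1) div 2"
  have half: "(2 * d + 1) div 2 = d" by simp
  have "griesmer (Suc (Suc (Suc (Suc (Suc (Suc 0)))))) (2 * d) = 2 * d + (d + (e1 + (e2 + (e3 + (e4 + 0)))))"
    unfolding griesmer.simps half e4_def e3_def e2_def e1_def ..
  moreover have "Suc (Suc (Suc (Suc (Suc (Suc 0))))) = 6" by simp
  ultimately have sum: "e1 + e2 + e3 + e4 \<le> 3 * s" using assms(2) by simp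
  have e: "d \<le> 2 * e1" "e1 \<le> 2 * e2" "e2 \<le> 2 * e3" "e3 \<le> 2 * e4"
    unfolding e4_def e3_def e2_def e1_def by linarith+
  have "1 \<le> e1" "1 \<le> e2" "1 \<le> e3" "1 \<le> e4" using e assms(1) by linarith+
  then show "2 \<le> s" using sum by linarith
  define t where "t = s div 5"
  have "s mod 5 = 0 \<or> s mod 5 = 1 \<or> s mod 5 = 2 \<or> s mod 5 = 3 \<or> s mod 5 = 4" by linarith
  moreover have "s = 5 * t + s mod 5" by (simp add: t_def)
  ultimately consider "s = 5 * t" "s mod 5 = 0" | "s = 5 * t + 1" "s mod 5 = 1"
    | "s = 5 * t + 2" "s mod 5 = 2" | "s = 5 * t + 3" "s mod 5 = 3" | "s = 5 * t + 4" "s mod 5 = 4"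
    by fastforce
  then show "d + s \<le> 21 * (s div 5) + [0, 1, 6, 11, 16] ! (s mod 5)"
  proof cases
    \<comment> \<open>In each case a larger d is propagated through the roundings. The four terms
      then sum to at least 15t + 4, 4, 7, 11 or 14 in the five cases, while 3s is 15t + 0, 3, 6, 9
      or 12.\<close>
    case 1
    show ?thesis
    proof (rule ccontr)
      assume "\<not> ?thesis"
      then have "16 * t + 1 \<le> d"
        unfolding t_def[symmetric] 1(2) using 1(1) by simp
      then have e1: "8 * t + 1 \<le> e1" using e(1) by linarith
      then have e2: "4 * t + 1 \<le> e2" using e(2) by linarith
      then have e3: "2 * t + 1 \<le> e3" using e(3) by linarith
      then have "t + 1 \<le> e4" using e(4) by linarith
      then show False using sum e1 e2 e3 1(1) by linarith
    qed
  next
    case 2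
    show ?thesis
    proof (rule ccontr)
      assume "\<not> ?thesis"
      then have "16 * t + 1 \<le> d"
        unfolding t_def[symmetric] 2(2) using 2(1) by simp
      then have e1: "8 * t + 1 \<le> e1" using e(1) by linarith
      then have e2: "4 * t + 1 \<le> e2" using e(2) by linarith
      then have e3: "2 * t + 1 \<le> e3" using e(3) by linarith
      then have "t + 1 \<le> e4" using e(4) by linarith
      then show False using sum e1 e2 e3 2(1) by linarith
    qed
  next
    case 3
    show ?thesis
    proof (rule ccontr)
      assume "\<not> ?thesis"
      then have "16 * t + 5 \<le> d"
        unfolding t_def[symmetric] 3(2) using 3(1) by simp
      then have e1: "8 * t + 3 \<le> e1" using e(1) by linarith
      then have e2: "4 * t + 2 \<le> e2" using e(2) by linarith
      then have e3: "2 * t + 1 \<le> e3" using e(3) by linarith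
      then have "t + 1 \<le> e4" using e(4) by linarith
      then show False using sum e1 e2 e3 3(1) by linarith
    qed
  next
    case 4
    show ?thesis
    proof (rule ccontr)
      assume "\<not> ?thesis"
      then have "16 * t + 9 \<le> d"
        unfolding t_def[symmetric] 4(2) using 4(1) by simp
      then have e1: "8 * t + 5 \<le> e1" using e(1) by linarith
      then have e2: "4 * t + 3 \<le> e2" using e(2) by linarith
      then have e3: "2 * t + 2 \<le> e3" using e(3) by linarith
      then have "t + 1 \<le> e4" using e(4) by linarith
      then show False using sum e1 e2 e3 4(1) by linarith
    qed
  next
    case 5
    show ?thesis
    proof (rule ccontr)
      assume "\<not> ?thesis"
      then have "16 * t + 13 \<le> d"
        unfolding t_def[symmetric] 5(2) using 5(1) by simp
      then have e1: "8 * t + 7 \<le> e1" using e(1) by linarith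
      then have e2: "4 * t + 4 \<le> e2" using e(2) by linarith
      then have e3: "2 * t + 2 \<le> e3" using e(3) by linarith
      then have "t + 1 \<le> e4" using e(4) by linarith
      then show False using sum e1 e2 e3 5(1) by linarith
    qed
  qed
qed

section \<open>Point sets of the projective plane of order four\<close>

definition dot :: "'f::field \<times> 'f \<times> 'f \<Rightarrow> 'f \<times> 'f \<times> 'f \<Rightarrow> 'f" where
  "dot = (\<lambda>(a, b, c) (x, y, z). a * x + b * y + c * z)"

definition hits :: "('f::field \<times> 'f \<times> 'f) list \<Rightarrow> 'f \<times> 'f \<times> 'f \<Rightarrow> nat" where
  "hits ps v = length (filter (\<lambda>p. dot v p = 0) ps)"

lemma dot_add: "dot (v + w) p = dot v p + dot w p"
  and dot_diff: "dot (v - w) p = dot v p - dot w p"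
  by (simp_all add: dot_def plus_prod_def minus_prod_def split: prod.splits) (simp_all add: algebra_simps)

lemma dot_scale: "dot (k * a, k * b, k * c) p = k * dot (a, b, c) p"
  by (simp add: dot_def algebra_simps split: prod.splits)

lemma min_distanceI:
  assumes "\<And>x y. x \<in> D \<Longrightarrow> y \<in> D \<Longrightarrow> x \<noteq> y \<Longrightarrow> d \<le> hamming_dist n x y"
    and "x \<in> D" "y \<in> D" "x \<noteq> y" "hamming_dist n x y = d"
  shows "min_distance n D = d"
  unfolding min_distance_def
proof (rule Min_eqI[OF finite_distances])
  show "d \<in> {hamming_dist n x y |x y. x \<in> D \<and> y \<in> D \<and> x \<noteq> y}"
    using assms(2-5) by blast
qed (use assms(1) in blast)

text \<open>The points are the columns of a generator matrix, and the zeros of the codeword of v are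
  the points on the line v. The line \<open>v0\<close> makes the species exactly
  \<open>s\<close>.\<close>

lemma linear_code_of_points:
  fixes ps :: "('f::field \<times> 'f \<times> 'f) list"
  assumes F: "CARD('f) = 4"
    and le: "\<And>v. v \<noteq> 0 \<Longrightarrow> hits ps v \<le> s" and eq: "v0 \<noteq> 0" "hits ps v0 = s"
    and s: "s < length ps"
  shows "length ps \<in> linear_lengths TYPE('f) 3 s"
proof -
  define n where "n = length ps"
  define enc where "enc v = (\<lambda>i. if i < n then dot v (ps ! i) else 0)" for v
  let ?C = "range enc"
  have fin: "finite (UNIV :: 'f set)" using F card.infinite by fastforce
  have enc_diff: "enc (v - w) = enc v - enc w" and enc_add: "enc (v + w) = enc v + enc w" for v w
    by (auto simp: enc_def dot_diff dot_add)
  have hits_card: "card {i. i < n \<and> enc v i = 0} = hits ps v" for v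
    unfolding hits_def length_filter_conv_card n_def enc_def
    by (intro arg_cong[where f = card]) auto
  have dist: "hamming_dist n (enc v) (enc w) + hits ps (v - w) = n" for v w
  proof -
    have "hamming_dist n (enc v) (enc w) + card {i. i < n \<and> enc (v - w) i = 0} =
        card ({i. i < n \<and> enc v i \<noteq> enc w i} \<union> {i. i < n \<and> enc (v - w) i = 0})"
      unfolding hamming_dist_def enc_diff by (subst card_Un_disjoint) auto
    also have "{i. i < n \<and> enc v i \<noteq> enc w i} \<union> {i. i < n \<and> enc (v - w) i = 0} = {..<n}"
      unfolding enc_diff by auto
    finally show ?thesis by (simp add: hits_card)
  qed
  \<comment> \<open>Two vectors with the same codeword would differ by a line containing all n > s
    points.\<close>
  have "inj enc"
  proof (rule injI, rule ccontr)
    fix v w assume "enc v = enc w" "v \<noteq> w"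
    then have "hits ps (v - w) = n" using dist[of v w] by (simp add: hamming_dist_def)
    then show False using le[of "v - w"] \<open>v \<noteq> w\<close> s by (simp add: n_def)
  qed
  then have "card ?C = CARD('f \<times> 'f \<times> 'f)" by (rule card_image)
  then have card_C: "card ?C = 4 ^ 3" using F by (simp add: card_prod)
  have C0: "0 \<in> ?C"
  proof
    show "0 = enc 0" by (auto simp: enc_def dot_def zero_prod_def split: prod.splits)
  qed simp
  have sub: "word.subspace ?C"
  proof (rule word.subspaceI)
    fix x y assume "x \<in> ?C" "y \<in> ?C"
    then show "x + y \<in> ?C" by (auto simp flip: enc_add)
  next
    fix k x assume "x \<in> ?C"
    then obtain v where v: "x = enc v" by blast
    obtain a b c where abc: "v = (a, b, c)" by (cases v)
    have "word_scale k x = enc (k * a, k * b, k * c)"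
      unfolding v abc enc_def word_scale_def dot_scale by auto
    then show "word_scale k x \<in> ?C" by blast
  qed (rule C0)
  have "finite ?C" by (rule ccontr) (use card_C in simp)
  then have "4 ^ word.dim ?C = (4 ^ 3 :: nat)"
    using card_subspace[OF fin _ sub] card_C F by simp
  then have dim: "word.dim ?C = 3" by (simp only: power_inject_exp)
  have "min_distance n ?C = n - s"
  proof (rule min_distanceI)
    fix x y assume "x \<in> ?C" "y \<in> ?C" "x \<noteq> y"
    then obtain v w where "x = enc v" "y = enc w" "v \<noteq> w" by blast
    then show "n - s \<le> hamming_dist n x y" using dist[of v w] le[of "v - w"] by simp
  next
    show "enc v0 \<in> ?C" "enc 0 \<in> ?C" by blast+
    show "enc v0 \<noteq> enc 0" using \<open>inj enc\<close> eq(1) by (simp add: inj_eq)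
    show "hamming_dist n (enc v0) (enc 0) = n - s" using dist[of v0 0] eq(2) by simp
  qed
  then have "linear_code n 3 (n - s) ?C"
    using sub dim by (auto simp: linear_code_def words_def enc_def)
  then show ?thesis
    unfolding linear_lengths_def using s unfolding n_def by fastforce
qed

lemma hits_append: "hits (ps @ qs) v = hits ps v + hits qs v"
  by (simp add: hits_def)

lemma hits_replicate: "hits (concat (replicate t ps)) v = t * hits ps v"
  by (induction t) (simp_all add: hits_append, simp add: hits_def)

text \<open>Translation by 1 permutes the field, so summing gives 4 = 0 and hence 2 = 0. For w
  outside {0, 1}, the square of w is none of 0, 1, w.\<close>

lemma four_elements:
  assumes F: "CARD('f::field) = 4"
  obtains w :: "'f::field" where "w \<noteq> 0" "w \<noteq> 1" "1 + 1 = (0 :: 'f)" "w * w = w + 1" "UNIV = {0, 1, w, w + 1}"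
proof -
  have fin: "finite (UNIV :: 'f set)" using F card.infinite by fastforce
  have "bij (\<lambda>x::'f. x + 1)"
    by (rule bij_betw_byWitness[where f' = "\<lambda>x. x - 1"]) auto
  then have "(\<Sum>x\<in>UNIV. x + 1) = (\<Sum>x\<in>UNIV. x :: 'f)"
    by (rule sum.reindex_bij_betw)
  then have "of_nat (CARD('f)) = (0 :: 'f)" by (simp add: sum.distrib)
  then have "(1 + 1) * (1 + 1) = (0 :: 'f)" using F by simp
  then have two: "1 + 1 = (0 :: 'f)" unfolding mult_eq_0_iff by blast
  then have dbl: "x + x = 0" for x :: 'f using distrib_right[of 1 1 x] by simp
  have "\<not> (UNIV :: 'f set) \<subseteq> {0, 1}" using card_mono[of "{0, 1 :: 'f}" UNIV] F by auto
  then obtain w :: 'f where w: "w \<noteq> 0" "w \<noteq> 1" by blast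
  have "w + 1 \<noteq> 0" using w(2) dbl[of 1] by (metis add_right_cancel)
  then have card: "card {0, 1, w, w + 1} = 4" using w by simp
  then have U: "UNIV = {0, 1, w, w + 1}"
    using F fin by (metis card_subset_eq subset_UNIV)
  have "w * w \<noteq> 0" "w * w \<noteq> w" using w by simp_all
  moreover have "w * w \<noteq> 1"
  proof
    assume "w * w = 1"
    then have "(w + 1) * (w + 1) = 0" using dbl[of w] dbl[of 1] by (simp add: algebra_simps)
    then show False using \<open>w + 1 \<noteq> 0\<close> by simp
  qed
  ultimately have "w * w = w + 1" using U by blast
  then show thesis using that w two U by blast
qed

text \<open>Both elements outside the prime field are named, so that statements about the plane
  reduce to finitely many evaluations by the tables below.\<close>

locale field_of_four =
  fixes w v :: "'f::field"
  assumes w: "w \<noteq> 0" "w \<noteq> 1" and two: "1 + 1 = (0 :: 'f)" and v: "w * w = v" "w + 1 = v"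
    and UNIV: "UNIV = {0, 1, w, v}"
begin

lemma sum_table:
  "1 + 1 = (0 :: 'f)" "w + w = 0" "v + v = 0" "1 + w = v" "w + 1 = v" "1 + v = w" "v + 1 = w"
  "w + v = 1" "v + w = 1"
proof -
  have d: "x + x = 0" for x :: 'f using distrib_right[of 1 1 x] two by simp
  then have l: "x + (x + y) = y" for x y :: 'f by (simp flip: add.assoc)
  show "1 + 1 = (0 :: 'f)" "w + w = 0" "v + v = 0" by (rule d)+
  show "w + 1 = v" by (rule v(2))
  then show "1 + w = v" by (simp add: add.commute)
  then show "1 + v = w" using l[of 1 w] by simp
  then show "v + 1 = w" by (simp add: add.commute)
  show "w + v = 1" using l[of w 1] v(2) by simp
  then show "v + w = 1" by (simp add: add.commute)
qed

lemma prod_table: "w * w = v" "w * v = 1" "v * w = 1" "v * v = w"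
proof -
  show "w * w = v" by (rule v(1))
  show *: "w * v = 1" using distrib_left[of w w 1] v sum_table by simp
  then show "v * w = 1" by (simp add: mult.commute)
  then show "v * v = w" using distrib_left[of v w 1] v sum_table by simp
qed

lemma distinct: "v \<noteq> 0" "v \<noteq> 1" "w \<noteq> v" "v \<noteq> w" "0 \<noteq> v" "1 \<noteq> v" "0 \<noteq> w" "1 \<noteq> w"
proof -
  show *: "v \<noteq> 0" using sum_table(8) w by auto
  show **: "v \<noteq> 1" using v(2) w by auto
  show ***: "w \<noteq> v" using v(2) by auto
  show "v \<noteq> w" "0 \<noteq> v" "1 \<noteq> v" "0 \<noteq> w" "1 \<noteq> w" using * ** *** w by simp_all
qed

lemma all_elements: "(\<forall>x. P x) \<longleftrightarrow> P 0 \<and> P 1 \<and> P w \<and> P v"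
proof -
  have "(\<forall>x. P x) \<longleftrightarrow> (\<forall>x\<in>{0, 1, w, v}. P x)" unfolding UNIV[symmetric] by simp
  then show ?thesis by simp
qed

definition affine_points :: "('f \<times> 'f \<times> 'f) list" where
  "affine_points = [(1, 0, 0), (1, 0, 1), (1, 0, w), (1, 0, v), (1, 1, 0), (1, 1, 1), (1, 1, w), (1, 1, v),
     (1, w, 0), (1, w, 1), (1, w, w), (1, w, v), (1, v, 0), (1, v, 1), (1, v, w), (1, v, v)]"

definition plane_points :: "('f \<times> 'f \<times> 'f) list" where
  "plane_points = affine_points @ [(0, 1, 0), (0, 1, 1), (0, 1, w), (0, 1, v), (0, 0, 1)]"

text \<open>The conic consisting of all (1, x, x^2) and (0, 0, 1), together with its nucleus (0, 1,
  0).\<close>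

definition hyperoval :: "('f \<times> 'f \<times> 'f) list" where
  "hyperoval = [(1, 0, 0), (1, 1, 1), (1, w, v), (1, v, w), (0, 1, 0), (0, 0, 1)]"

text \<open>The points with x^3 + y^3 + z^3 = 0. Nonzero cubes are 1, so exactly one coordinate
  vanishes.\<close>

definition hermitian_curve :: "('f \<times> 'f \<times> 'f) list" where
  "hermitian_curve = [(0, 1, 1), (0, 1, w), (0, 1, v), (1, 0, 1), (1, 0, w), (1, 0, v),
     (1, 1, 0), (1, w, 0), (1, v, 0)]"

text \<open>As a multiset: the plane without the line x = 0 and the plane without the line y =
  0.\<close>

definition line_pair_complement :: "('f \<times> 'f \<times> 'f) list" where
  "line_pair_complement = affine_points @ map (\<lambda>(x, y, z). (y, x, z)) affine_points"

lemma hits_Nil: "hits [] u = 0"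
  and hits_Cons: "hits (p # ps) u = (if dot u p = 0 then 1 else 0) + hits ps u"
  by (simp_all add: hits_def)

lemmas hits_eval = hits_Nil hits_Cons dot_def prod.case sum_table prod_table distinct w
  mult_zero_left mult_zero_right mult_1_left mult_1_right add_0_left add_0_right
  zero_neq_one one_neq_zero refl if_True if_False simp_thms

text \<open>For nonzero \<open>a\<close>, the vector (a, 0, 0) is the line at infinity.\<close>

lemma hits_affine:
  "hits affine_points (a, b, c) = (if b = 0 \<and> c = 0 then if a = 0 then 16 else 0 else 4)"
proof -
  have "\<forall>a b c. hits affine_points (a, b, c) = (if b = 0 \<and> c = 0 then if a = 0 then 16 else 0 else 4)"
    unfolding all_elements affine_points_def
    by (intro conjI; simp only: hits_eval; simp?)
  then show ?thesis by blast
qed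

lemma hits_plane: "u \<noteq> 0 \<Longrightarrow> hits plane_points u = 5"
proof (cases u)
  case (fields a b c)
  have "\<forall>b c. hits [(0, 1, 0), (0, 1, 1), (0, 1, w), (0, 1, v), (0, 0, 1)] (a, b, c) =
      (if b = 0 \<and> c = 0 then 5 else 1)"
    unfolding all_elements
    by (intro conjI; simp only: hits_eval; simp?)
  moreover assume "u \<noteq> 0"
  ultimately show ?thesis
    unfolding fields plane_points_def hits_append hits_affine by (auto simp: zero_prod_def)
qed

lemma hits_hyperoval: "u \<noteq> 0 \<Longrightarrow> hits hyperoval u \<le> 2"
proof (cases u)
  case (fields a b c)
  have "\<forall>a b c. \<not> (a = 0 \<and> b = 0 \<and> c = 0) \<longrightarrow> hits hyperoval (a, b, c) \<le> 2"
    unfolding all_elements hyperoval_def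
    by (intro conjI; simp only: hits_eval; simp?)
  then show "u \<noteq> 0 \<Longrightarrow> ?thesis" unfolding fields by (auto simp: zero_prod_def)
qed

lemma hits_hermitian: "u \<noteq> 0 \<Longrightarrow> hits hermitian_curve u \<le> 3"
proof (cases u)
  case (fields a b c)
  have "\<forall>a b c. \<not> (a = 0 \<and> b = 0 \<and> c = 0) \<longrightarrow> hits hermitian_curve (a, b, c) \<le> 3"
    unfolding all_elements hermitian_curve_def
    by (intro conjI; simp only: hits_eval; simp?)
  then show "u \<noteq> 0 \<Longrightarrow> ?thesis" unfolding fields by (auto simp: zero_prod_def)
qed

lemma hits_line_pair:
  "hits line_pair_complement (a, b, c) = hits affine_points (a, b, c) + hits affine_points (b, a, c)"
  unfolding line_pair_complement_def hits_append
  by (simp add: hits_def dot_def filter_map o_def case_prod_unfold add_ac)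

end

section \<open>Maximal lengths\<close>

text \<open>Among the first ten symbols, a nonzero codeword vanishes in at most n - d = 3, so a code
  of length at least ten satisfies the assumptions of \<open>ten_pairs\<close>.\<close>

lemma additive_length_3_le:
  assumes "n \<in> additive_lengths 3 3"
  shows "n \<le> 9"
proof (rule ccontr)
  assume "\<not> n \<le> 9"
  obtain d C where C: "n = d + 3" "0 < d" "C \<subseteq> words (2 * n)" "word.subspace C" "card C = 64"
    and weight: "\<And>x. x \<in> C \<Longrightarrow> x \<noteq> 0 \<Longrightarrow> d \<le> card {i. i < n \<and> pair_symbols x i \<noteq> (0, 0)}"
    using additive_lengthsE[OF assms] by blast
  have double: "exponent_two TYPE(nat \<Rightarrow> bit)"
    by unfold_locales (simp add: fun_eq_iff bit_double)
  interpret ten_pairs "TYPE(nat \<Rightarrow> bit)" C "\<lambda>i x. x (2 * i)" "\<lambda>i x. x (2 * i + 1)"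
  proof (intro ten_pairs.intro double ten_pairs_axioms.intro)
    show "exponent_two.subgrp C"
      using C(4) by (simp add: exponent_two.subgrp_def[OF double] word.subspace_0 word.subspace_add)
  next
    fix u assume u: "u \<in> C" "u \<noteq> 0"
    let ?W = "{i. i < n \<and> pair_symbols u i \<noteq> (0, 0)}"
    have "card {i. i < 10 \<and> u (2 * i) = 0 \<and> u (2 * i + 1) = 0} + card ?W =
        card ({i. i < 10 \<and> u (2 * i) = 0 \<and> u (2 * i + 1) = 0} \<union> ?W)"
      by (subst card_Un_disjoint) (auto simp: pair_symbols_def)
    also have "\<dots> \<le> card {..<n}"
      using \<open>\<not> n \<le> 9\<close> by (intro card_mono) auto
    finally show "card {i. i < 10 \<and> u (2 * i) = 0 \<and> u (2 * i + 1) = 0} \<le> 3"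
      using weight[OF u] C(1) by simp
  qed (simp_all add: C(5))
  show False by (rule contradiction)
qed

text \<open>The Griesmer values, corrected at \<open>s = 3\<close> from 11 to 9.\<close>

definition best_length :: "nat \<Rightarrow> nat" where
  "best_length s = (if s = 3 then 9 else 21 * (s div 5) + [0, 1, 6, 11, 16] ! (s mod 5))"

lemma additive_lengths_le:
  assumes "n \<in> additive_lengths 3 s"
  shows "2 \<le> s" "n \<le> best_length s"
proof -
  obtain d where "n = d + s" "0 < d" "griesmer 6 (2 * d) \<le> 3 * n"
    using additive_griesmer[OF assms] by blast
  then show "2 \<le> s" "n \<le> best_length s"
    using griesmer_6[of d s] additive_length_3_le[of n] assms by (auto simp: best_length_def)
qed

lemma min_distance_comp:
  assumes "inj h"
  shows "min_distance n ((\<lambda>x. h \<circ> x) ` C) = min_distance n C"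
proof -
  have h: "hamming_dist n (h \<circ> x) (h \<circ> y) = hamming_dist n x y" for x y
    using assms by (simp add: hamming_dist_def inj_eq)
  have i: "h \<circ> x = h \<circ> y \<longleftrightarrow> x = y" for x y :: "nat \<Rightarrow> 'a"
    using assms by (auto simp: fun_eq_iff inj_eq)
  have "{hamming_dist n x y | x y. x \<in> (\<lambda>x. h \<circ> x) ` C \<and> y \<in> (\<lambda>x. h \<circ> x) ` C \<and> x \<noteq> y} =
      {hamming_dist n x y | x y. x \<in> C \<and> y \<in> C \<and> x \<noteq> y}"
    (is "?L = ?R")
  proof (intro equalityI subsetI)
    fix m assume "m \<in> ?L"
    then obtain x y where "m = hamming_dist n (h \<circ> x) (h \<circ> y)" "x \<in> C" "y \<in> C" "h \<circ> x \<noteq> h \<circ> y"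
      by blast
    then show "m \<in> ?R" unfolding h i by blast
  next
    fix m assume "m \<in> ?R"
    then obtain x y where xy: "m = hamming_dist n x y" "x \<in> C" "y \<in> C" "x \<noteq> y" by blast
    have "m = hamming_dist n (h \<circ> x) (h \<circ> y)" "h \<circ> x \<noteq> h \<circ> y" using xy(1,4) unfolding h i by auto
    then show "m \<in> ?L" using xy(2,3) by blast
  qed
  then show ?thesis by (simp add: min_distance_def)
qed

context field_of_four
begin

section \<open>Linear codes of maximal length\<close>

lemma card_UNIV: "CARD('f) = 4"
  unfolding UNIV using distinct w by simp

text \<open>Every line meets the whole plane in five of its 21 points, so each copy adds the same
  amount to all lines.\<close>

lemma juxtaposition_length:
  fixes ps :: "('f \<times> 'f \<times> 'f) list"
  assumes "\<And>u. u \<noteq> 0 \<Longrightarrow> hits ps u \<le> r" "u0 \<noteq> 0" "hits ps u0 = r"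
    and "5 * t + r < 21 * t + length ps"
  shows "21 * t + length ps \<in> linear_lengths TYPE('f) 3 (5 * t + r)"
proof -
  define qs where "qs = concat (replicate t plane_points) @ ps"
  have len: "length qs = 21 * t + length ps"
    unfolding qs_def by (induction t) (simp_all add: plane_points_def affine_points_def)
  have hits: "hits qs u = 5 * t + hits ps u" if "u \<noteq> 0" for u
    using hits_plane[OF that] by (simp add: qs_def hits_append hits_replicate)
  have "length qs \<in> linear_lengths TYPE('f) 3 (5 * t + r)"
    using assms by (intro linear_code_of_points[OF card_UNIV, of _ _ u0]) (simp_all add: hits len)
  then show ?thesis unfolding len .
qed

lemma best_length_attained:
  assumes "2 \<le> s"
  shows "best_length s \<in> linear_lengths TYPE('f) 3 s"
proof -
  define t where "t = s div 5"
  have unit: "(1, 0, 0) \<noteq> (0 :: 'f \<times> 'f \<times> 'f)" "(0, 1, 0) \<noteq> (0 :: 'f \<times> 'f \<times> 'f)"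
    "(0, 0, 1) \<noteq> (0 :: 'f \<times> 'f \<times> 'f)"
    by (simp_all add: zero_prod_def)
  have "s mod 5 = 0 \<or> s mod 5 = 1 \<or> s mod 5 = 2 \<or> s mod 5 = 3 \<or> s mod 5 = 4" by linarith
  moreover have "s = 5 * t + s mod 5" by (simp add: t_def)
  ultimately consider "s = 5 * t" "s mod 5 = 0" | "s = 5 * t + 1" "s mod 5 = 1"
    | "s = 5 * t + 2" "s mod 5 = 2" | "s = 5 * t + 3" "s mod 5 = 3" | "s = 5 * t + 4" "s mod 5 = 4"
    by fastforce
  then show ?thesis
  proof cases
    case 1
    then have "0 < t" "best_length s = 21 * t" using assms by (auto simp: best_length_def t_def)
    then show ?thesis
      using juxtaposition_length[of "[]" 0 "(1, 0, 0)" t] unit 1(1) by (simp add: hits_Nil)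
  next
    case 2
    then have "0 < t" using assms by simp
    moreover have "best_length s = 21 * t + 1"
      unfolding best_length_def t_def[symmetric] 2(2) using 2(1) by simp
    \<comment> \<open>The zero coordinate raises length and species by one without changing
      distances.\<close>
    moreover have "hits [(0, 0, 0)] u = 1" for u :: "'f \<times> 'f \<times> 'f"
      by (cases u) (simp add: hits_def dot_def)
    ultimately show ?thesis
      using juxtaposition_length[of "[(0, 0, 0)]" 1 "(1, 0, 0)" t] unit 2(1) by simp
  next
    case 3
    have "best_length s = 21 * t + 6"
      unfolding best_length_def t_def[symmetric] 3(2) using 3(1) by simp
    moreover have "hits hyperoval (0, 1, 0) = 2"
      by (simp add: hits_def dot_def hyperoval_def w distinct)
    moreover have "length hyperoval = 6" by (simp add: hyperoval_def)
    ultimately show ?thesis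
      using juxtaposition_length[of hyperoval 2 "(0, 1, 0)" t] unit 3(1) hits_hyperoval
      by simp
  next
    case 4
    show ?thesis
    proof (cases "t = 0")
      case True
      moreover have "hits hermitian_curve (1, 0, 0) = 3"
        by (simp add: hits_def dot_def hermitian_curve_def)
      moreover have "length hermitian_curve = 9" by (simp add: hermitian_curve_def)
      ultimately show ?thesis
        using juxtaposition_length[of hermitian_curve 3 "(1, 0, 0)" 0] unit 4(1) hits_hermitian
        by (simp add: best_length_def)
    next
      case False
      \<comment> \<open>One copy of the plane is given up: 21 + 11 = 32 points with at most 5 + 3 =
        8 on a line.\<close>
      then have "best_length s = 21 * (t - 1) + 32" "s = 5 * (t - 1) + 8"
        unfolding best_length_def t_def[symmetric] 4(2) using 4(1) by auto
      moreover have "hits line_pair_complement u \<le> 8" if "u \<noteq> 0" for u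
        using that by (cases u) (auto simp: hits_line_pair hits_affine zero_prod_def)
      moreover have "hits line_pair_complement (0, 0, 1) = 8"
        by (simp add: hits_line_pair hits_affine)
      moreover have "length line_pair_complement = 32"
        by (simp add: line_pair_complement_def affine_points_def)
      ultimately show ?thesis
        using juxtaposition_length[of line_pair_complement 8 "(0, 0, 1)" "t - 1"] unit by simp
    qed
  next
    case 5
    have "best_length s = 21 * t + 16"
      unfolding best_length_def t_def[symmetric] 5(2) using 5(1) by simp
    moreover have "hits affine_points u \<le> 4" if "u \<noteq> 0" for u
      using that by (cases u) (auto simp: hits_affine zero_prod_def)
    moreover have "hits affine_points (0, 1, 0) = 4" by (simp add: hits_affine)
    moreover have "length affine_points = 16" by (simp add: affine_points_def)
    ultimately show ?thesis
      using juxtaposition_length[of affine_points 4 "(0, 1, 0)" t] unit 5(1) by simp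
  qed
qed

section \<open>Linear codes regarded as additive codes\<close>

definition bits :: "'f \<Rightarrow> bit \<times> bit" where
  "bits x = (if x = 0 then (0, 0) else if x = 1 then (1, 0) else if x = w then (0, 1) else (1, 1))"

lemma bits_add: "bits (x + y) = bits x + bits y"
proof -
  have "(2 :: 'f) = 0" using sum_table(1) by simp
  then have "\<forall>x y. bits (x + y) = bits x + bits y"
    unfolding all_elements by (simp add: bits_def sum_table distinct w)
  then show ?thesis by blast
qed

lemma inj_bits: "inj bits"
proof -
  have "\<forall>x y. bits x = bits y \<longrightarrow> x = y"
    unfolding all_elements by (simp add: bits_def distinct w)
  then show ?thesis by (blast intro: injI)
qed

lemma linear_lengths_subset: "linear_lengths TYPE('f) 3 s \<subseteq> additive_lengths 3 s"
proof
  fix n assume "n \<in> linear_lengths TYPE('f) 3 s"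
  then obtain d C where code: "linear_code n 3 d (C :: (nat \<Rightarrow> 'f) set)" and n: "n = d + s"
    unfolding linear_lengths_def by blast
  then have C: "C \<subseteq> words n" "word.subspace C" "word.dim C = 3" "min_distance n C = d"
    unfolding linear_code_def by blast+
  have fin: "finite (UNIV :: 'f set)" unfolding UNIV by simp
  have "finite C" using finite_subset[OF C(1) finite_words[OF fin]] .
  then have card_C: "card C = 64"
    using card_subspace[OF fin _ C(2)] C(3) card_UNIV by simp
  \<comment> \<open>Each symbol is written in coordinates with respect to the basis 1, w over the
    prime field, so 64 = 4^3 = 2^6 codewords give binary dimension 6.\<close>
  define expand :: "(nat \<Rightarrow> 'f) \<Rightarrow> nat \<Rightarrow> bit" where
    "expand x = (\<lambda>j. if even j then fst (bits (x (j div 2))) else snd (bits (x (j div 2))))" for x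
  let ?C = "expand ` C"
  have pair: "pair_symbols (expand x) = bits \<circ> x" for x
    by (simp add: pair_symbols_def expand_def fun_eq_iff)
  have bits0: "bits 0 = (0, 0)" by (simp add: bits_def)
  have expand_add: "expand (x + y) = expand x + expand y" for x y
    by (simp add: expand_def fun_eq_iff bits_add)
  have "inj expand"
  proof (rule injI)
    fix x y assume "expand x = expand y"
    then have "bits \<circ> x = bits \<circ> y" by (simp flip: pair)
    then show "x = y" using inj_bits by (auto simp: fun_eq_iff inj_eq)
  qed
  then have card: "card ?C = 2 ^ 6" using card_C by (simp add: card_image inj_on_subset[OF _ subset_UNIV])
  have expand0: "expand 0 = 0" by (simp add: expand_def fun_eq_iff bits0)
  have zero: "0 \<in> ?C" using word.subspace_0[OF C(2)] expand0 by (metis imageI)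
  have sub: "word.subspace ?C"
  proof (rule word.subspaceI)
    fix x y assume "x \<in> ?C" "y \<in> ?C"
    then show "x + y \<in> ?C"
      using word.subspace_add[OF C(2)] by (auto simp flip: expand_add)
  next
    fix k x assume x: "x \<in> ?C"
    show "word_scale k x \<in> ?C"
    proof (cases "k = 0")
      case True
      then show ?thesis using zero by simp
    next
      case False
      then have "k = 1" using bit_not_zero_iff by blast
      then show ?thesis using x by simp
    qed
  qed (rule zero)
  have "finite ?C" by (rule ccontr) (use card in simp)
  then have "2 ^ word.dim ?C = (2 ^ 6 :: nat)"
    using card_subspace[OF card_bit(2) _ sub] card by (simp add: card_bit)
  then have dim: "word.dim ?C = 6" by (simp only: power_inject_exp)
  have "pair_symbols ` ?C = (\<lambda>x. bits \<circ> x) ` C" by (simp add: image_image pair)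
  then have "min_distance n (pair_symbols ` ?C) = d"
    using min_distance_comp[OF inj_bits] C(4) by simp
  moreover have "?C \<subseteq> words (2 * n)"
  proof clarify
    fix x assume "x \<in> C"
    then have "x i = 0" if "n \<le> i" for i using C(1) that by (auto simp: words_def)
    then show "expand x \<in> words (2 * n)" by (simp add: words_def expand_def bits0)
  qed
  ultimately have "additive_code n 3 d ?C" using sub dim by (simp add: additive_code_def)
  then show "n \<in> additive_lengths 3 s" using n unfolding additive_lengths_def by blast
qed

text \<open>For \<open>s\<close> at least 2, \<open>best_length s\<close> is attained by a linear
  code and bounds all additive ones, so it is the maximum of both sets. Below 2 both sets are empty
  and the suprema agree.\<close>

lemma max_lengths:
  "max_additive_length 3 s = max_linear_length TYPE('f) 3 s"
proof (cases "2 \<le> s")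
  case True
  have "best_length s \<in> linear_lengths TYPE('f) 3 s" by (rule best_length_attained[OF True])
  moreover have "n \<le> best_length s" if "n \<in> additive_lengths 3 s" for n
    using additive_lengths_le(2)[OF that] .
  ultimately have "Sup (additive_lengths 3 s) = best_length s"
    "Sup (linear_lengths TYPE('f) 3 s) = best_length s"
    using linear_lengths_subset[of s] by (auto intro!: cSup_eq_maximum)
  then show ?thesis by (simp add: max_additive_length_def max_linear_length_def)
next
  case False
  then have "additive_lengths 3 s = {}" using additive_lengths_le(1) by blast
  then show ?thesis
    using linear_lengths_subset[of s] by (simp add: max_additive_length_def max_linear_length_def)
qed

end

theorem theorem1:
  fixes s :: nat
  assumes "CARD('f::field) = 4" and "0 < s"
  shows "max_additive_length 3 s = max_linear_length TYPE('f) 3 s"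
proof -
  obtain w :: 'f where "w \<noteq> 0" "w \<noteq> 1" "1 + 1 = (0 :: 'f)" "w * w = w + 1" "UNIV = {0, 1, w, w + 1}"
    using four_elements[OF assms(1)] by blast
  then interpret field_of_four w "w + 1" by unfold_locales (assumption | rule refl)+
  show ?thesis by (rule max_lengths)
qed

end
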